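(* (i) There exists a constant $c_2>0$, independent of $C$, $M$ and $\sigma^2$, such that for all $M\ge 2$, all $\sigma^2>0$ and all $C\in\mathbb{R}^{M\times M}$, $$\delta_{C,M,\sigma^2,1}\ \le\ c_2\Big(\sigma^2M+\sigma\sqrt{M}\,\|C\|_{S_\infty}\Big),$$ where $\|C\|_{S_\infty}$ denotes the spectral norm of $C$. (ii) There exist constants $c_3>0$ and $M_0\in\mathbb{N}$, independent of $\sigma^2$, such that for all $\sigma^2>0$ $$\inf_{C\in\mathbb{R}^{M\times M}}\delta_{C,M,\sigma^2,1}\ \ge\ c_3\,\sigma^2(M-1)\qquad\text{for all } M\ge M_0.$$
   Context: Let $M\in\mathbb{N}$, $\sigma^2>0$ (with $\sigma>0$), and let $\mathrm{E}$ be a random $M\times M$ real matrix whose entries are independent centered Gaussian random variables with variance $\sigma^2$. For $1\le r\le M$, $\mathcal{S}_{M,r}\subset\mathbb{R}^{M\times M}$ is the set of all matrices of orthogonal projections onto $r$-dimensional linear subspaces of $\mathbb{R}^M$. $\|\cdot\|_{S_2}$ is the Hilbert-Schmidt (Frobenius) norm. For a deterministic matrix $C\in\mathbb{R}^{M\times M}$ put $X=C+\mathrm{E}$, let $\hat\pi_r$ be a maximizer of $\tilde\pi_r\mapsto\|\tilde\pi_rX\|_{S_2}^2$ over $\mathcal{S}_{M,r}$, and let $\pi_r$ be a (deterministic) maximizer of $\tilde\pi_r\mapsto\mathbf{E}\|\tilde\pi_rX\|_{S_2}^2$ over $\mathcal{S}_{M,r}$ (equivalently, of $\|\tilde\pi_rC\|_{S_2}^2$).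 Define $$\delta_{C,M,\sigma^2,r}:=\mathbf{E}\|\hat\pi_rX\|_{S_2}^2-\mathbf{E}\|\pi_rX\|_{S_2}^2=\sum_{i=1}^r\mathbf{E}\big(\hat\lambda_i^2-\lambda_i^2-\sigma^2M\big),$$ where $\hat\lambda_1\ge\dots\ge\hat\lambda_M$ and $\lambda_1\ge\dots\ge\lambda_M$ are the singular values of $X$ and $C$. The theorem concerns $r=1$. *)

theory Defs
  imports
    "HOL-Probability.Probability"
    "Jordan_Normal_Form.VS_Connect"
begin

text \<open>The dimension \<open>M\<close> is quantified below the constants of the theorem, so matrices are those of
  the Jordan normal form library, where \<open>M\<close> is a term, rather than \<open>real ^ 'n ^ 'n\<close>.\<close>

definition hs_norm :: "real mat \<Rightarrow> real" where
  "hs_norm A = sqrt (\<Sum>i<dim_row A. \<Sum>j<dim_col A. (A $$ (i, j))\<^sup>2)"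

definition euclid_norm :: "real vec \<Rightarrow> real" where
  "euclid_norm v = sqrt (v \<bullet> v)"

text \<open>The spectral norm is the operator norm induced by the Euclidean norm. The supremum is over a
  nonempty set as soon as \<open>A\<close> has a column.\<close>

definition spectral_norm :: "real mat \<Rightarrow> real" where
  "spectral_norm A =
     (SUP v \<in> {v \<in> carrier_vec (dim_col A). euclid_norm v = 1}. euclid_norm (A *\<^sub>v v))"

definition is_orth_proj_onto :: "nat \<Rightarrow> real vec set \<Rightarrow> real mat \<Rightarrow> bool" where
  "is_orth_proj_onto M V P \<longleftrightarrow>
     P \<in> carrier_mat M M \<and>
     (\<forall>v \<in> carrier_vec M. P *\<^sub>v v \<in> V \<and> (\<forall>w \<in> V. (v - P *\<^sub>v v) \<bullet> w = 0))"

definition orth_projs :: "nat \<Rightarrow> nat \<Rightarrow> real mat set" where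
  "orth_projs M r =
     {P. \<exists>V. VectorSpace.subspace class_ring V (module_vec TYPE(real) M) \<and>
             vectorspace.dim class_ring (module_vec TYPE(real) M\<lparr>carrier := V\<rparr>) = r \<and>
             is_orth_proj_onto M V P}"

definition gaussian_matrix ::
  "'w measure \<Rightarrow> nat \<Rightarrow> real \<Rightarrow> ('w \<Rightarrow> real mat) \<Rightarrow> bool" where
  "gaussian_matrix \<Omega> M \<sigma> E \<longleftrightarrow>
     prob_space \<Omega> \<and>
     (\<forall>\<omega> \<in> space \<Omega>. E \<omega> \<in> carrier_mat M M) \<and>
     prob_space.indep_vars \<Omega> (\<lambda>_. borel) (\<lambda>ij \<omega>. E \<omega> $$ ij) ({..<M} \<times> {..<M}) \<and>
     (\<forall>i<M. \<forall>j<M. distributed \<Omega> lborel (\<lambda>\<omega>. E \<omega> $$ (i, j)) (normal_density 0 \<sigma>))"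

text \<open>Maximizers are picked by Hilbert choice. They need not be unique, but only the attained maximum
  enters \<open>excess\<close>, so the value does not depend on the choice.\<close>

definition pi_hat :: "nat \<Rightarrow> nat \<Rightarrow> real mat \<Rightarrow> real mat" where
  "pi_hat M r X = arg_max_on (\<lambda>P. (hs_norm (P * X))\<^sup>2) (orth_projs M r)"

definition pi_opt :: "'w measure \<Rightarrow> nat \<Rightarrow> nat \<Rightarrow> ('w \<Rightarrow> real mat) \<Rightarrow> real mat" where
  "pi_opt \<Omega> M r X =
     arg_max_on (\<lambda>P. \<integral>\<omega>. (hs_norm (P * X \<omega>))\<^sup>2 \<partial>\<Omega>) (orth_projs M r)"

text \<open>The quantity \<open>\<delta>\<close> for \<open>X = C + E\<close>; the variance enters only through the law of \<open>E\<close>.\<close>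

definition excess ::
  "'w measure \<Rightarrow> ('w \<Rightarrow> real mat) \<Rightarrow> nat \<Rightarrow> nat \<Rightarrow> real mat \<Rightarrow> real" where
  "excess \<Omega> E M r C =
     (let X = (\<lambda>\<omega>. C + E \<omega>) in
       (\<integral>\<omega>. (hs_norm (pi_hat M r (X \<omega>) * X \<omega>))\<^sup>2 \<partial>\<Omega>)
       - (\<integral>\<omega>. (hs_norm (pi_opt \<Omega> M r X * X \<omega>))\<^sup>2 \<partial>\<Omega>))"

end

theory Submission
  imports Defs
begin

text \<open>
  Write \<open>\<lambda>\<close> for the operator norm of \<open>C\<close>. The projections of rank one are the matrices
  \<open>u u\<^sup>T\<close> with a unit vector \<open>u\<close> (\<open>orth_projs_1\<close>), and \<open>u u\<^sup>T X\<close> has Hilbert-Schmidt norm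
  \<open>|X\<^sup>T u|\<close>. Since \<open>|X\<^sup>T u|\<^sup>2\<close> has mean \<open>|C\<^sup>T u|\<^sup>2 + \<sigma>\<^sup>2 M\<close>, the excess is the mean of
  \<open>\<parallel>X\<parallel>\<^sup>2 - \<lambda>\<^sup>2 - \<sigma>\<^sup>2 M\<close>, and everything reduces to the mean of the squared operator norm of
  \<open>X = C + E\<close>.

  Upper bound. By the triangle inequality \<open>\<parallel>X\<parallel>\<^sup>2 \<le> \<lambda>\<^sup>2 + 2 \<lambda> \<parallel>E\<parallel> + \<parallel>E\<parallel>\<^sup>2\<close>, so it suffices that
  \<open>\<parallel>E\<parallel>\<close> is of order \<open>\<sigma> \<surd>M\<close> in mean and in mean square. The norm is controlled by the values
  \<open>z\<^sup>T E w\<close> with \<open>z\<close>, \<open>w\<close> in a lattice net of at most \<open>384 ^ M\<close> points (\<open>opn_le_grid\<close>,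
  \<open>card_grid_le\<close>). Each value is a centered Gaussian, so its square has a bounded exponential
  moment (\<open>lin_exp_square\<close>); summing these over the net costs a factor exponential in \<open>M\<close>, which
  a fourth moment sees only as \<open>M\<^sup>2\<close> (\<open>noise_norm_fourth\<close>).

  Lower bound. Let \<open>v\<close> be a unit vector with \<open>|C v| = \<lambda>\<close>, so that \<open>C\<^sup>T C v = \<lambda>\<^sup>2 v\<close>. One step of the
  power method started at \<open>v\<close> gives \<open>|X\<^sup>T X v|\<^sup>2 \<le> \<parallel>X\<parallel>\<^sup>2 |X v|\<^sup>2\<close>. Both vectors are polynomials in
  the noise, and with the moments of Gaussian linear forms up to order four one finds, for
  \<open>S = \<lambda>\<^sup>2 + \<sigma>\<^sup>2 M\<close>, that \<open>|X v|\<^sup>2\<close> has mean \<open>S\<close> while \<open>|X\<^sup>T X v|\<^sup>2\<close> has mean at least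
  \<open>S (\<lambda>\<^sup>2 + 2 \<sigma>\<^sup>2 M)\<close> (\<open>power_step_second_moment\<close>). If \<open>\<parallel>X\<parallel>\<^sup>2\<close> and \<open>|X v|\<^sup>2\<close> were uncorrelated,
  dividing by \<open>S\<close> would give \<open>\<lambda>\<^sup>2 + 2 \<sigma>\<^sup>2 M\<close> as a lower bound for the mean of \<open>\<parallel>X\<parallel>\<^sup>2\<close>, hence
  \<open>\<sigma>\<^sup>2 M\<close> for the excess. Their covariance is of order \<open>\<sigma>\<^sup>2 \<surd>M S\<close>, because \<open>|X v|\<^sup>2\<close> has standard
  deviation of order \<open>\<sigma> \<surd>S\<close> and \<open>\<parallel>X\<parallel>\<^sup>2\<close> deviates from \<open>\<lambda>\<^sup>2\<close> by order \<open>\<sigma> \<surd>(M S)\<close> in mean square, so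
  the loss is of order \<open>\<sigma>\<^sup>2 \<surd>M\<close>, uniformly in \<open>C\<close> (\<open>opn_obs_square_lower\<close>).
\<close>

section \<open>Square matrices as functions and their operator norm\<close>

definition dot :: "nat \<Rightarrow> (nat \<Rightarrow> real) \<Rightarrow> (nat \<Rightarrow> real) \<Rightarrow> real" where
  "dot M x y = (\<Sum>i<M. x i * y i)"

abbreviation vnorm :: "nat \<Rightarrow> (nat \<Rightarrow> real) \<Rightarrow> real" where
  "vnorm M x \<equiv> L2_set x {..<M}"

definition mv :: "nat \<Rightarrow> (nat \<Rightarrow> nat \<Rightarrow> real) \<Rightarrow> (nat \<Rightarrow> real) \<Rightarrow> nat \<Rightarrow> real" where
  "mv M A x = (\<lambda>i. \<Sum>j<M. A i j * x j)"

definition tmat :: "(nat \<Rightarrow> nat \<Rightarrow> real) \<Rightarrow> nat \<Rightarrow> nat \<Rightarrow> real" where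
  "tmat A i j = A j i"

lemma tmat_tmat [simp]: "tmat (tmat A) = A"
  by (simp add: tmat_def fun_eq_iff)

text \<open>The supremum is a maximum and the values are bounded as soon as \<open>0 < M\<close>; for \<open>M = 0\<close> there is no
  unit vector and the value is unspecified.\<close>

definition opn :: "nat \<Rightarrow> (nat \<Rightarrow> nat \<Rightarrow> real) \<Rightarrow> real" where
  "opn M A = (SUP x\<in>{x. vnorm M x = 1}. vnorm M (mv M A x))"

lemma vnorm_sq: "(vnorm M x)\<^sup>2 = (\<Sum>i<M. (x i)\<^sup>2)"
  by (simp add: L2_set_def sum_nonneg)

lemma dot_self: "dot M x x = (vnorm M x)\<^sup>2"
  unfolding vnorm_sq by (simp add: dot_def power2_eq_square)

lemma dot_le_vnorm: "\<bar>dot M x y\<bar> \<le> vnorm M x * vnorm M y"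
proof -
  have "\<bar>dot M x y\<bar> \<le> (\<Sum>i<M. \<bar>x i\<bar> * \<bar>y i\<bar>)"
    unfolding dot_def by (rule order_trans[OF sum_abs]) (simp add: abs_mult)
  also have "\<dots> \<le> vnorm M x * vnorm M y" by (rule L2_set_mult_ineq)
  finally show ?thesis .
qed

lemma dot_commute: "dot M x y = dot M y x"
  by (simp add: dot_def mult.commute)

lemma dot_scale_right: "dot M x (\<lambda>i. c * y i) = c * dot M x y"
  by (simp add: dot_def sum_distrib_left mult.left_commute)

lemma vnorm_scale: "vnorm M (\<lambda>i. c * x i) = \<bar>c\<bar> * vnorm M x"
  by (simp add: L2_set_def power_mult_distrib sum_distrib_left[symmetric] real_sqrt_mult)

lemma vnorm_sq_diff: "(vnorm M (\<lambda>i. x i - y i))\<^sup>2 = (vnorm M x)\<^sup>2 - 2 * dot M x y + (vnorm M y)\<^sup>2"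
  by (simp add: vnorm_sq dot_def power2_diff sum.distrib sum_subtractf sum_distrib_left algebra_simps)

lemma mv_scale: "mv M A (\<lambda>i. c * x i) = (\<lambda>i. c * mv M A x i)"
  by (simp add: mv_def sum_distrib_left mult.left_commute)

lemma mv_diff: "mv M A (\<lambda>i. x i - y i) = (\<lambda>i. mv M A x i - mv M A y i)"
  by (simp add: mv_def sum_subtractf right_diff_distrib)

lemma mv_add_mat: "mv M (\<lambda>i j. A i j + B i j) x = (\<lambda>i. mv M A x i + mv M B x i)"
  by (simp add: mv_def sum.distrib distrib_right)

lemma dot_mv_tmat: "dot M x (mv M A y) = dot M (mv M (tmat A) x) y"
proof -
  have "dot M x (mv M A y) = (\<Sum>i<M. \<Sum>j<M. x i * (A i j * y j))"
    by (simp add: dot_def mv_def sum_distrib_left)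
  also have "\<dots> = (\<Sum>j<M. \<Sum>i<M. x i * (A i j * y j))" by (rule sum.swap)
  also have "\<dots> = dot M (mv M (tmat A) x) y"
    by (simp add: dot_def mv_def tmat_def sum_distrib_left sum_distrib_right mult_ac)
  finally show ?thesis .
qed

text \<open>Compactness of the unit sphere. Functions on \<open>nat\<close> that vanish from \<open>M\<close> on and have values of
  modulus at most 1 below \<open>M\<close> form a compact set by Tychonoff's theorem, and the sphere condition
  cuts out a closed subset of it; any other unit vector agrees below \<open>M\<close> with one of these.\<close>

lemma unit_vector_maximizing:
  assumes "0 < M"
  shows "\<exists>v. vnorm M v = 1 \<and> (\<forall>x. vnorm M x = 1 \<longrightarrow> vnorm M (mv M A x) \<le> vnorm M (mv M A v))"
proof -
  define R where "R = (\<Pi>\<^sub>E i\<in>(UNIV::nat set). if i < M then {-1..1::real} else {0})"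
  define S where "S = {x::nat \<Rightarrow> real. (\<Sum>i<M. (x i)\<^sup>2) = 1}"
  have R: "compact R"
    unfolding R_def compactin_euclidean_iff[symmetric] euclidean_product_topology[symmetric]
    by (subst compactin_PiE) auto
  have c1: "continuous_on UNIV (\<lambda>x::nat\<Rightarrow>real. (\<Sum>i<M. (x i)\<^sup>2))"
    by (intro continuous_intros) simp
  have "closed S"
    unfolding S_def using continuous_closed_preimage_constant[OF c1 closed_UNIV, of 1] by simp
  then have comp: "compact (R \<inter> S)" using R by (rule compact_Int_closed[rotated])
  have "(\<lambda>i. if i = 0 then 1 else 0) \<in> R \<inter> S"
    using assms by (auto simp: R_def S_def if_distrib[of "\<lambda>x. x\<^sup>2"] sum.delta cong: if_cong)
  then have ne: "R \<inter> S \<noteq> {}" by blast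
  have c2: "continuous_on (R \<inter> S) (\<lambda>x. vnorm M (mv M A x))"
    unfolding L2_set_def mv_def
    by (intro continuous_intros continuous_on_subset[OF continuous_on_product_coordinates]) auto
  obtain v where v: "v \<in> R \<inter> S" and mx: "\<forall>y\<in>R \<inter> S. vnorm M (mv M A y) \<le> vnorm M (mv M A v)"
    using continuous_attains_sup[OF comp ne c2] by blast
  have "vnorm M (mv M A x) \<le> vnorm M (mv M A v)" if x: "vnorm M x = 1" for x
  proof -
    define y where "y = (\<lambda>i. if i < M then x i else 0)"
    have sq: "(\<Sum>i<M. (x i)\<^sup>2) = 1" using x vnorm_sq[of x M] by simp
    then have "(x i)\<^sup>2 \<le> 1" if "i < M" for i
      using member_le_sum[of i "{..<M}" "\<lambda>i. (x i)\<^sup>2"] that by simp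
    then have "\<bar>x i\<bar> \<le> 1" if "i < M" for i
      using that abs_le_square_iff[of "x i" 1] by simp
    then have "y \<in> R" by (force simp: R_def y_def abs_le_iff)
    moreover have "y \<in> S" using sq by (simp add: S_def y_def)
    moreover have "mv M A y = mv M A x" by (simp add: mv_def y_def)
    ultimately show ?thesis using mx by (metis IntI)
  qed
  moreover have "vnorm M v = 1" using v by (simp add: S_def L2_set_def)
  ultimately show ?thesis by blast
qed

lemma opn_attained:
  assumes "0 < M"
  obtains v where "vnorm M v = 1" "vnorm M (mv M A v) = opn M A"
proof -
  obtain v where v: "vnorm M v = 1" "\<And>x. vnorm M x = 1 \<Longrightarrow> vnorm M (mv M A x) \<le> vnorm M (mv M A v)"
    using unit_vector_maximizing[OF assms] by blast
  have "opn M A = vnorm M (mv M A v)"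
    unfolding opn_def by (rule cSup_eq_maximum) (use v in auto)
  then show ?thesis using that v by simp
qed

lemma opn_nonneg: "0 < M \<Longrightarrow> 0 \<le> opn M A"
  by (metis opn_attained L2_set_nonneg)

lemma vnorm_eq_0: "vnorm M x = 0 \<Longrightarrow> i < M \<Longrightarrow> x i = 0"
  by (simp add: L2_set_eq_0_iff)

lemma vnorm_mv_le:
  assumes "0 < M"
  shows "vnorm M (mv M A x) \<le> opn M A * vnorm M x"
proof (cases "vnorm M x = 0")
  case True
  then have "x j = 0" if "j < M" for j using that by (rule vnorm_eq_0)
  then have "mv M A x = (\<lambda>i. 0)" by (simp add: mv_def)
  then show ?thesis using True by (simp add: L2_set_def)
next
  case False
  then have pos: "vnorm M x > 0" using L2_set_nonneg[of x "{..<M}"] by linarith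
  obtain v where v: "vnorm M v = 1" "\<And>y. vnorm M y = 1 \<Longrightarrow> vnorm M (mv M A y) \<le> vnorm M (mv M A v)"
    using unit_vector_maximizing[OF assms] by blast
  let ?y = "\<lambda>i. (1 / vnorm M x) * x i"
  have "vnorm M ?y = 1" using pos by (simp only: vnorm_scale) simp
  then have "vnorm M (mv M A ?y) \<le> opn M A"
    unfolding opn_def by (intro cSUP_upper) (auto intro!: bdd_aboveI2 v(2))
  then show ?thesis using pos by (simp only: mv_scale vnorm_scale) (simp add: field_simps)
qed

lemma opn_leI:
  assumes "0 < M" "\<And>x. vnorm M x = 1 \<Longrightarrow> vnorm M (mv M A x) \<le> a"
  shows "opn M A \<le> a"
  using opn_attained[OF assms(1)] assms(2) by metis

lemma opn_add_le:
  assumes "0 < M"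
  shows "opn M (\<lambda>i j. A i j + B i j) \<le> opn M A + opn M B"
proof (rule opn_leI[OF assms])
  fix x assume x: "vnorm M x = 1"
  have "vnorm M (mv M (\<lambda>i j. A i j + B i j) x) \<le> vnorm M (mv M A x) + vnorm M (mv M B x)"
    unfolding mv_add_mat by (rule L2_set_triangle_ineq)
  also have "\<dots> \<le> opn M A + opn M B"
    using vnorm_mv_le[OF assms, of A x] vnorm_mv_le[OF assms, of B x] x by simp
  finally show "vnorm M (mv M (\<lambda>i j. A i j + B i j) x) \<le> opn M A + opn M B" .
qed

text \<open>With \<open>y = A\<^sup>T x\<close> one has \<open>|y|\<^sup>2 = x \<bullet> A y \<le> \<parallel>A\<parallel> |y|\<close>.\<close>

lemma opn_tmat_le:
  assumes "0 < M"
  shows "opn M (tmat A) \<le> opn M A"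
proof (rule opn_leI[OF assms])
  fix x assume x: "vnorm M x = 1"
  let ?y = "mv M (tmat A) x"
  have "(vnorm M ?y)\<^sup>2 = dot M x (mv M A ?y)"
    by (simp add: dot_self[symmetric] dot_mv_tmat)
  also have "\<dots> \<le> vnorm M x * (opn M A * vnorm M ?y)"
    using dot_le_vnorm[of M x "mv M A ?y"] vnorm_mv_le[OF assms, of A ?y] x by simp
  finally have "vnorm M ?y * vnorm M ?y \<le> opn M A * vnorm M ?y" using x by (simp add: power2_eq_square)
  then show "vnorm M ?y \<le> opn M A"
    using L2_set_nonneg[of ?y "{..<M}"] opn_nonneg[OF assms, of A]
    by (cases "vnorm M ?y = 0") auto
qed

lemma opn_tmat: "0 < M \<Longrightarrow> opn M (tmat A) = opn M A"
  using opn_tmat_le[of M A] opn_tmat_le[of M "tmat A"] by (intro antisym) auto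

text \<open>For a maximizing unit vector \<open>v\<close>, the vector \<open>A\<^sup>T A v\<close> has length at most \<open>\<parallel>A\<parallel>\<^sup>2\<close> and inner product
  exactly \<open>\<parallel>A\<parallel>\<^sup>2\<close> with \<open>v\<close>: this is the case of equality in the Cauchy-Schwarz inequality. Stating the
  eigenvector equation for \<open>A\<^sup>T A\<close> avoids a left singular vector, which is not determined by \<open>v\<close> when
  \<open>\<parallel>A\<parallel> = 0\<close>.\<close>

lemma top_singular_vector:
  assumes "0 < M"
  obtains v where "vnorm M v = 1" "vnorm M (mv M A v) = opn M A"
    "\<And>i. i < M \<Longrightarrow> mv M (tmat A) (mv M A v) i = (opn M A)\<^sup>2 * v i"
proof -
  obtain v where v: "vnorm M v = 1" "vnorm M (mv M A v) = opn M A"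
    using opn_attained[OF assms] by blast
  let ?q = "mv M (tmat A) (mv M A v)" and ?l = "opn M A"
  have d: "dot M ?q v = ?l\<^sup>2" by (simp add: dot_mv_tmat[symmetric] dot_self v)
  have "vnorm M ?q \<le> ?l * ?l"
    using vnorm_mv_le[OF assms, of "tmat A" "mv M A v"] by (simp add: v opn_tmat[OF assms])
  then have "(vnorm M ?q)\<^sup>2 \<le> (?l\<^sup>2)\<^sup>2"
    by (intro power_mono) (auto simp: power2_eq_square)
  moreover have "(vnorm M (\<lambda>i. ?q i - ?l\<^sup>2 * v i))\<^sup>2 = (vnorm M ?q)\<^sup>2 - 2 * (?l\<^sup>2 * ?l\<^sup>2) + (?l\<^sup>2)\<^sup>2"
    unfolding vnorm_sq_diff vnorm_scale dot_scale_right d by (simp add: v)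
  ultimately have "(vnorm M (\<lambda>i. ?q i - ?l\<^sup>2 * v i))\<^sup>2 \<le> 0"
    using power2_eq_square[of "?l\<^sup>2"] by linarith
  then have "vnorm M (\<lambda>i. ?q i - ?l\<^sup>2 * v i) = 0" by simp
  then have "?q i = ?l\<^sup>2 * v i" if "i < M" for i using vnorm_eq_0[OF _ that] by fastforce
  then show ?thesis using that v by blast
qed

text \<open>One step of the power method never overshoots: \<open>|A\<^sup>T A v| \<le> \<parallel>A\<parallel> |A v|\<close>. The main lower bound takes
  means in this inequality.\<close>

lemma power_step_le_opn:
  assumes "0 < M"
  shows "(vnorm M (mv M (tmat A) (mv M A v)))\<^sup>2 \<le> (opn M A)\<^sup>2 * (vnorm M (mv M A v))\<^sup>2"
  unfolding power_mult_distrib[symmetric]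
  using vnorm_mv_le[OF assms, of "tmat A" "mv M A v"] opn_tmat[OF assms, of A]
  by (intro power_mono) auto

lemma mv_cong: "(\<And>i j. i < M \<Longrightarrow> j < M \<Longrightarrow> A i j = B i j) \<Longrightarrow> i < M \<Longrightarrow> mv M A x i = mv M B x i"
  by (simp add: mv_def)

lemma vnorm_mv_cong: "(\<And>i j. i < M \<Longrightarrow> j < M \<Longrightarrow> A i j = B i j) \<Longrightarrow> vnorm M (mv M A x) = vnorm M (mv M B x)"
  by (intro L2_set_cong refl) (auto intro: mv_cong)

lemma opn_cong:
  assumes "\<And>i j. i < M \<Longrightarrow> j < M \<Longrightarrow> A i j = B i j"
  shows "opn M A = opn M B"
proof -
  have "(\<lambda>x. vnorm M (mv M A x)) = (\<lambda>x. vnorm M (mv M B x))"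
    by (intro ext vnorm_mv_cong assms)
  then show ?thesis by (simp only: opn_def)
qed

section \<open>Integer vectors that determine the operator norm\<close>

text \<open>Integer labels of the net; \<open>gridvec\<close> scales them by the mesh \<open>1 / (2 \<surd>M)\<close>. Rounding moves each
  coordinate by at most half a mesh, hence a vector by at most \<open>1/4\<close> in norm, so the rounded unit
  vectors have norm at most \<open>5/4\<close>, that is, labels with sum of squares at most \<open>25/4 M \<le> 7 M\<close>. The box
  constraint follows from this bound and makes finiteness evident.\<close>

definition grid :: "nat \<Rightarrow> (nat \<Rightarrow> int) set" where
  "grid M = {z \<in> {..<M} \<rightarrow>\<^sub>E {- 7 * int M..7 * int M}. (\<Sum>i<M. (z i)\<^sup>2) \<le> 7 * int M}"

definition gridvec :: "nat \<Rightarrow> (nat \<Rightarrow> int) \<Rightarrow> nat \<Rightarrow> real" where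
  "gridvec M z i = real_of_int (z i) / (2 * sqrt (real M))"

lemma finite_grid: "finite (grid M)"
  unfolding grid_def by (rule finite_subset[OF _ finite_PiE[of "{..<M}" "\<lambda>_. {- 7 * int M..7 * int M}"]]) auto

lemma vnorm_gridvec:
  assumes "z \<in> grid M" "0 < M"
  shows "(vnorm M (gridvec M z))\<^sup>2 \<le> 2"
proof -
  have "real_of_int (\<Sum>i<M. (z i)\<^sup>2) \<le> real_of_int (7 * int M)"
    using assms by (subst of_int_le_iff) (simp add: grid_def)
  then show ?thesis using assms(2)
    by (simp add: vnorm_sq gridvec_def power_divide power_mult_distrib sum_divide_distrib[symmetric] field_simps)
qed

lemma sum_half_powers_le: "(\<Sum>k\<in>{- int n..int n}. (1/2::real) ^ nat \<bar>k\<bar>) = 3 - 2 / 2 ^ n"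
proof (induction n)
  case (Suc n)
  let ?f = "\<lambda>k. (1/2::real) ^ nat \<bar>k\<bar>"
  have "{- int (Suc n)..int (Suc n)} = insert (- int (Suc n)) (insert (int (Suc n)) {- int n..int n})" by auto
  then have "(\<Sum>k\<in>{- int (Suc n)..int (Suc n)}. ?f k) = ?f (- int (Suc n)) + (?f (int (Suc n)) + (\<Sum>k\<in>{- int n..int n}. ?f k))"
    by simp
  also have "\<dots> = 1 / 2 ^ Suc n + (1 / 2 ^ Suc n + (3 - 2 / 2 ^ n))"
    unfolding Suc by (simp add: nat_add_distrib power_one_over)
  finally show ?case by (simp add: field_simps)
qed simp

lemma abs_le_square: "\<bar>k::int\<bar> \<le> k\<^sup>2"
proof (cases "k = 0")
  case False
  then have "\<bar>k\<bar> * 1 \<le> \<bar>k\<bar> * \<bar>k\<bar>" by (intro mult_left_mono) auto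
  then show ?thesis by (simp add: power2_eq_square)
qed simp

text \<open>Counting by weights: give the label \<open>z\<close> the weight \<open>\<Prod>i<M. 2 ^ (- |z i|)\<close>. Labels in the grid have
  weight at least \<open>2 ^ (- 7 M)\<close> since \<open>|z i| \<le> (z i)\<^sup>2\<close>, while the total weight of the box factors into
  \<open>M\<close> geometric sums, each at most 3; and \<open>2 ^ 7 * 3 = 384\<close>.\<close>

lemma card_grid_le: "real (card (grid M)) \<le> 384 ^ M"
proof -
  let ?B = "{..<M} \<rightarrow>\<^sub>E {- 7 * int M..7 * int M}"
  have fB: "finite ?B" by (intro finite_PiE) auto
  have le: "1 \<le> 2 ^ (7 * M) * (\<Prod>i<M. (1/2::real) ^ nat \<bar>z i\<bar>)" if z: "z \<in> grid M" for z
  proof -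
    have "int (\<Sum>i<M. nat \<bar>z i\<bar>) \<le> (\<Sum>i<M. (z i)\<^sup>2)"
      unfolding of_nat_sum by (intro sum_mono) (simp add: abs_le_square)
    also have "\<dots> \<le> 7 * int M" using z by (simp add: grid_def)
    finally have s: "(\<Sum>i<M. nat \<bar>z i\<bar>) \<le> 7 * M" by linarith
    have "1 = 2 ^ (7 * M) * (1/2::real) ^ (7 * M)" by (simp add: power_one_over)
    also have "\<dots> \<le> 2 ^ (7 * M) * (1/2) ^ (\<Sum>i<M. nat \<bar>z i\<bar>)"
      using s by (intro mult_left_mono power_decreasing) auto
    also have "(1/2::real) ^ (\<Sum>i<M. nat \<bar>z i\<bar>) = (\<Prod>i<M. (1/2::real) ^ nat \<bar>z i\<bar>)"
      by (rule power_sum)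
    finally show ?thesis .
  qed
  have "real (card (grid M)) = (\<Sum>z\<in>grid M. 1)" by simp
  also have "\<dots> \<le> (\<Sum>z\<in>grid M. 2 ^ (7 * M) * (\<Prod>i<M. (1/2::real) ^ nat \<bar>z i\<bar>))"
    by (intro sum_mono le)
  also have "\<dots> \<le> (\<Sum>z\<in>?B. 2 ^ (7 * M) * (\<Prod>i<M. (1/2::real) ^ nat \<bar>z i\<bar>))"
  proof (rule sum_mono2[OF fB])
    show "grid M \<subseteq> ?B" unfolding grid_def by blast
    show "0 \<le> 2 ^ (7 * M) * (\<Prod>i<M. (1/2::real) ^ nat \<bar>z i\<bar>)" for z :: "nat \<Rightarrow> int"
      by (intro mult_nonneg_nonneg prod_nonneg) auto
  qed
  also have "\<dots> = 2 ^ (7 * M) * (\<Prod>i<M. \<Sum>k\<in>{- 7 * int M..7 * int M}. (1/2::real) ^ nat \<bar>k\<bar>)"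
    unfolding sum_distrib_left[symmetric] by (subst prod_sum_PiE) (rule finite_lessThan finite_atLeastAtMost_int refl)+
  also have "\<dots> \<le> 2 ^ (7 * M) * (\<Prod>i<M. 3)"
  proof (intro mult_left_mono prod_mono conjI)
    show "(\<Sum>k\<in>{- 7 * int M..7 * int M}. (1/2::real) ^ nat \<bar>k\<bar>) \<le> 3"
      using sum_half_powers_le[of "7 * M"] by (simp del: power_one_over)
  qed (auto intro!: sum_nonneg)
  also have "\<dots> = 384 ^ M" by (simp add: power_mult power_mult_distrib[symmetric])
  finally show ?thesis .
qed

lemma grid_approx:
  assumes "0 < M" "vnorm M u = 1"
  obtains z where "z \<in> grid M" "vnorm M (\<lambda>i. u i - gridvec M z i) \<le> 1/4"
proof -
  define s where "s = 2 * sqrt (real M)"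
  have s: "s > 0" "s\<^sup>2 = 4 * real M" using assms by (auto simp: s_def power_mult_distrib)
  define z where "z = restrict (\<lambda>i. round (s * u i)) {..<M}"
  have zi: "\<bar>u i - gridvec M z i\<bar> \<le> 1 / (2 * s)" if "i < M" for i
  proof -
    have "\<bar>real_of_int (z i) - s * u i\<bar> \<le> 1/2"
      using of_int_round_abs_le[of "s * u i"] that by (simp add: z_def)
    then have "\<bar>- (real_of_int (z i) - s * u i) / s\<bar> \<le> (1/2) / s"
      using s(1) unfolding abs_divide abs_minus_cancel by (intro divide_mono) auto
    moreover have "u i - gridvec M z i = - (real_of_int (z i) - s * u i) / s"
      using s(1) unfolding gridvec_def s_def[symmetric] by (simp add: field_simps)
    ultimately show ?thesis by simp
  qed
  have "(vnorm M (\<lambda>i. u i - gridvec M z i))\<^sup>2 \<le> (\<Sum>i<M. (1 / (2 * s))\<^sup>2)"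
    unfolding vnorm_sq using zi s by (intro sum_mono) (simp add: abs_le_square_iff[symmetric])
  also have "\<dots> = (1/4)\<^sup>2" using s assms by (simp add: power_divide power_mult_distrib power2_eq_square)
  finally have d: "vnorm M (\<lambda>i. u i - gridvec M z i) \<le> 1/4"
    by (rule power2_le_imp_le) simp
  have "vnorm M (gridvec M z) \<le> vnorm M u + vnorm M (\<lambda>i. - 1 * (u i - gridvec M z i))"
    using L2_set_triangle_ineq[of u "\<lambda>i. - 1 * (u i - gridvec M z i)" "{..<M}"] by simp
  also have "\<dots> \<le> 5/4" using d assms unfolding vnorm_scale by simp
  finally have "(vnorm M (gridvec M z))\<^sup>2 \<le> (5/4)\<^sup>2" by (intro power_mono) auto
  then have "(\<Sum>i<M. (real_of_int (z i))\<^sup>2) / (4 * real M) \<le> 25/16"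
    using assms by (simp add: vnorm_sq gridvec_def power_divide power_mult_distrib sum_divide_distrib[symmetric])
  then have "(\<Sum>i<M. (real_of_int (z i))\<^sup>2) \<le> 7 * real M"
    using assms by (simp add: field_simps)
  then have "real_of_int (\<Sum>i<M. (z i)\<^sup>2) \<le> real_of_int (7 * int M)" by simp
  then have q: "(\<Sum>i<M. (z i)\<^sup>2) \<le> 7 * int M" by (subst (asm) of_int_le_iff)
  have "\<bar>z i\<bar> \<le> 7 * int M" if "i < M" for i
  proof -
    have "\<bar>z i\<bar> \<le> (z i)\<^sup>2"
      by (rule abs_le_square)
    also have "\<dots> \<le> (\<Sum>i<M. (z i)\<^sup>2)" using that by (intro member_le_sum) auto
    finally show ?thesis using q by linarith
  qed
  then have "z \<in> grid M" using q by (fastforce simp: grid_def z_def abs_le_iff)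
  then show ?thesis using that d by blast
qed

text \<open>Replacing unit vectors \<open>u\<close>, \<open>v\<close> with \<open>u \<bullet> A v = \<parallel>A\<parallel>\<close> by grid vectors changes the value by at most
  \<open>(1/4 \<cdot> 5/4 + 1/4) \<parallel>A\<parallel> = 9/16 \<parallel>A\<parallel>\<close>, so that \<open>7/16 \<parallel>A\<parallel> \<le> B\<close>.\<close>

lemma opn_le_grid:
  assumes M: "0 < M"
    and B: "\<And>z w. z \<in> grid M \<Longrightarrow> w \<in> grid M \<Longrightarrow> \<bar>dot M (gridvec M z) (mv M A (gridvec M w))\<bar> \<le> B"
  shows "opn M A \<le> 3 * B"
proof -
  obtain v where v: "vnorm M v = 1" "vnorm M (mv M A v) = opn M A" using opn_attained[OF M] by blast
  have nn: "0 \<le> opn M A" by (rule opn_nonneg[OF M])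
  show ?thesis
  proof (cases "opn M A = 0")
    case True
    obtain z where "z \<in> grid M" using grid_approx[OF M v(1)] by blast
    then show ?thesis using True B[of z z] by linarith
  next
    case False
    define u where "u = (\<lambda>i. (1 / opn M A) * mv M A v i)"
    have u: "vnorm M u = 1" unfolding u_def vnorm_scale using v False nn by simp
    have uAv: "dot M u (mv M A v) = opn M A"
    proof -
      have "dot M u (mv M A v) = (1 / opn M A) * dot M (mv M A v) (mv M A v)"
        unfolding u_def by (subst dot_commute) (rule dot_scale_right)
      then show ?thesis using False by (simp add: dot_self v power2_eq_square)
    qed
    obtain z where z: "z \<in> grid M" "vnorm M (\<lambda>i. u i - gridvec M z i) \<le> 1/4" using grid_approx[OF M u] by blast
    obtain w where w: "w \<in> grid M" "vnorm M (\<lambda>i. v i - gridvec M w i) \<le> 1/4" using grid_approx[OF M v(1)] by blast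
    let ?z = "gridvec M z" and ?w = "gridvec M w"
    have "vnorm M ?w \<le> vnorm M v + vnorm M (\<lambda>i. - 1 * (v i - ?w i))"
      using L2_set_triangle_ineq[of v "\<lambda>i. - 1 * (v i - ?w i)" "{..<M}"] by simp
    then have wn: "vnorm M ?w \<le> 5/4" using v w unfolding vnorm_scale by simp
    have "dot M u (mv M A v) = dot M ?z (mv M A ?w) + dot M (\<lambda>i. u i - ?z i) (mv M A ?w)
        + dot M u (mv M A (\<lambda>i. v i - ?w i))"
      unfolding mv_diff by (simp add: dot_def sum.distrib[symmetric] sum_subtractf[symmetric] algebra_simps)
    also have "\<dots> \<le> B + (1/4) * (opn M A * (5/4)) + 1 * (opn M A * (1/4))"
    proof (intro add_mono)
      show "dot M ?z (mv M A ?w) \<le> B" using B[OF z(1) w(1)] by linarith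
      have "dot M (\<lambda>i. u i - ?z i) (mv M A ?w) \<le> vnorm M (\<lambda>i. u i - ?z i) * vnorm M (mv M A ?w)"
        using dot_le_vnorm abs_le_D1 by blast
      also have "\<dots> \<le> 1/4 * (opn M A * (5/4))"
        using vnorm_mv_le[OF M, of A ?w] mult_left_mono[OF wn nn] by (intro mult_mono z(2)) auto
      finally show "dot M (\<lambda>i. u i - ?z i) (mv M A ?w) \<le> 1/4 * (opn M A * (5/4))" .
      have "dot M u (mv M A (\<lambda>i. v i - ?w i)) \<le> vnorm M u * vnorm M (mv M A (\<lambda>i. v i - ?w i))"
        using dot_le_vnorm abs_le_D1 by blast
      also have "\<dots> \<le> 1 * (opn M A * (1/4))"
        using vnorm_mv_le[OF M, of A "\<lambda>i. v i - ?w i"] mult_left_mono[OF w(2) nn] u by simp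
      finally show "dot M u (mv M A (\<lambda>i. v i - ?w i)) \<le> 1 * (opn M A * (1/4))" .
    qed
    finally have "7 / 16 * opn M A \<le> B" unfolding uAv by simp
    moreover have "0 \<le> B" using B[OF z(1) w(1)] by linarith
    ultimately show ?thesis by linarith
  qed
qed

text \<open>Directions of integer vectors are dense, so countably many inequalities, each measurable in the
  entries, decide whether the norm is at most \<open>a\<close>. In the proof a unit vector \<open>u\<close> is approximated by
  rounding \<open>n u\<close>, with an error of order \<open>1 / n\<close> after division by \<open>n\<close>.\<close>

lemma opn_le_iff_integer_vectors:
  assumes M: "0 < M" and a: "0 \<le> a"
  shows "opn M A \<le> a \<longleftrightarrow>
    (\<forall>z \<in> {..<M} \<rightarrow>\<^sub>E (UNIV::int set). vnorm M (mv M A (\<lambda>i. real_of_int (z i))) \<le> a * vnorm M (\<lambda>i. real_of_int (z i)))"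
    (is "_ \<longleftrightarrow> ?R")
proof
  assume "opn M A \<le> a"
  then show ?R using vnorm_mv_le[OF M] by (meson L2_set_nonneg mult_right_mono order_trans)
next
  assume R: ?R
  have "vnorm M (mv M A u) \<le> a" if u: "vnorm M u = 1" for u
  proof -
    define c where "c = (a + opn M A) * sqrt (real M)"
    have *: "vnorm M (mv M A u) \<le> a + c / real n" if n: "0 < n" for n
    proof -
      define z where "z = restrict (\<lambda>i. round (real n * u i)) {..<M}"
      define d where "d = (\<lambda>i. real n * u i - real_of_int (z i))"
      have di: "(d i)\<^sup>2 \<le> 1" if "i < M" for i
      proof -
        have "\<bar>d i\<bar> \<le> 1" using of_int_round_abs_le[of "real n * u i"] that
          unfolding d_def z_def by (subst abs_minus_commute) simp
        then show ?thesis using abs_le_square_iff[of "d i" 1] by simp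
      qed
      have "(vnorm M d)\<^sup>2 \<le> real M" unfolding vnorm_sq using sum_bounded_above[of "{..<M}" "\<lambda>i. (d i)\<^sup>2" 1] di by simp
      then have dn: "vnorm M d \<le> sqrt (real M)" by (simp add: real_le_rsqrt)
      let ?z = "\<lambda>i. real_of_int (z i)"
      have zR: "vnorm M (mv M A ?z) \<le> a * vnorm M ?z" by (rule R[rule_format]) (simp only: z_def restrict_PiE, simp)
      have "?z = (\<lambda>i. real n * u i + - 1 * d i)" by (simp add: d_def)
      then have "vnorm M ?z \<le> vnorm M (\<lambda>i. real n * u i) + vnorm M (\<lambda>i. - 1 * d i)"
        using L2_set_triangle_ineq[of "\<lambda>i. real n * u i" "\<lambda>i. - 1 * d i" "{..<M}"] by metis
      also have "\<dots> = real n + vnorm M d" unfolding vnorm_scale using u by simp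
      finally have zn: "vnorm M ?z \<le> real n + sqrt (real M)" using dn by linarith
      have "(\<lambda>i. real n * mv M A u i) = (\<lambda>i. mv M A ?z i + mv M A d i)"
        unfolding mv_scale[symmetric] by (simp add: mv_def d_def sum.distrib[symmetric] distrib_left[symmetric])
      then have "vnorm M (\<lambda>i. real n * mv M A u i) \<le> vnorm M (mv M A ?z) + vnorm M (mv M A d)"
        using L2_set_triangle_ineq[of "mv M A ?z" "mv M A d" "{..<M}"] by metis
      then have "real n * vnorm M (mv M A u) \<le> vnorm M (mv M A ?z) + vnorm M (mv M A d)"
        unfolding vnorm_scale by simp
      also have "\<dots> \<le> a * (real n + sqrt (real M)) + opn M A * sqrt (real M)"
        using zR mult_left_mono[OF zn a] vnorm_mv_le[OF M, of A d] mult_left_mono[OF dn opn_nonneg[OF M, of A]]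
        by linarith
      finally have "real n * vnorm M (mv M A u) \<le> real n * a + c" by (simp add: c_def algebra_simps)
      then show ?thesis using n by (simp add: field_simps)
    qed
    have "(\<lambda>n. a + c / real n) \<longlonglongrightarrow> a + 0"
      by (intro tendsto_intros lim_const_over_n)
    then show ?thesis
      by (intro LIMSEQ_le_const[of "\<lambda>n. a + c / real n"]) (use * in \<open>auto intro!: exI[of _ 1]\<close>)
  qed
  then show "opn M A \<le> a" by (rule opn_leI[OF M])
qed

lemma opn_measurable:
  assumes M: "0 < M"
    and A: "\<And>i j. i < M \<Longrightarrow> j < M \<Longrightarrow> (\<lambda>\<omega>. A \<omega> i j) \<in> borel_measurable N"
  shows "(\<lambda>\<omega>. opn M (A \<omega>)) \<in> borel_measurable N"
proof (rule borel_measurableI_le)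
  fix a :: real
  let ?Z = "{..<M} \<rightarrow>\<^sub>E (UNIV :: int set)"
  show "{\<omega> \<in> space N. opn M (A \<omega>) \<le> a} \<in> sets N"
  proof (cases "0 \<le> a")
    case True
    have c: "countable ?Z" by (intro countable_PiE) auto
    have "(\<lambda>\<omega>. vnorm M (mv M (A \<omega>) x)) \<in> borel_measurable N" for x
      unfolding L2_set_def mv_def using A
      by (intro borel_measurable_sqrt[THEN measurable_compose[rotated]] borel_measurable_sum borel_measurable_power
          borel_measurable_times borel_measurable_const) auto
    then have "{\<omega> \<in> space N. vnorm M (mv M (A \<omega>) (\<lambda>i. real_of_int (z i))) \<le> a * vnorm M (\<lambda>i. real_of_int (z i))} \<in> sets N" for z
      by measurable
    then have "{\<omega> \<in> space N. \<forall>z\<in>?Z. vnorm M (mv M (A \<omega>) (\<lambda>i. real_of_int (z i))) \<le> a * vnorm M (\<lambda>i. real_of_int (z i))} \<in> sets N"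
      by (intro sets.sets_Collect_countable_All' c)
    then show ?thesis unfolding opn_le_iff_integer_vectors[OF M True] .
  next
    case False
    then have "{\<omega> \<in> space N. opn M (A \<omega>) \<le> a} = {}"
      using opn_nonneg[OF M] by (auto simp: not_le intro: less_le_trans)
    then show ?thesis by (metis sets.empty_sets)
  qed
qed

section \<open>Orthogonal projections of rank one\<close>

definition rank1 :: "nat \<Rightarrow> (nat \<Rightarrow> real) \<Rightarrow> real mat" where
  "rank1 M u = mat M M (\<lambda>(i, j). u i * u j)"

definition entries :: "real mat \<Rightarrow> nat \<Rightarrow> nat \<Rightarrow> real" where
  "entries A i j = A $$ (i, j)"

lemma euclid_norm_eq: "v \<in> carrier_vec M \<Longrightarrow> euclid_norm v = vnorm M (\<lambda>i. v $ i)"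
  by (auto simp: euclid_norm_def L2_set_def scalar_prod_def power2_eq_square lessThan_atLeast0)

lemma mult_mat_vec_entries:
  "A \<in> carrier_mat M M \<Longrightarrow> v \<in> carrier_vec M \<Longrightarrow> i < M \<Longrightarrow> (A *\<^sub>v v) $ i = mv M (entries A) (\<lambda>j. v $ j) i"
  by (auto simp: mv_def entries_def scalar_prod_def lessThan_atLeast0 intro!: sum.cong)

lemma spectral_norm_eq_opn:
  assumes A: "A \<in> carrier_mat M M"
  shows "spectral_norm A = opn M (entries A)"
proof -
  have e: "euclid_norm (A *\<^sub>v v) = vnorm M (mv M (entries A) (\<lambda>j. v $ j))" if "v \<in> carrier_vec M" for v
  proof -
    have "A *\<^sub>v v \<in> carrier_vec M" using A that by auto
    then show ?thesis unfolding euclid_norm_eq[OF \<open>A *\<^sub>v v \<in> carrier_vec M\<close>]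
      by (intro L2_set_cong refl mult_mat_vec_entries[OF A that]) auto
  qed
  have "(\<lambda>v. euclid_norm (A *\<^sub>v v)) ` {v \<in> carrier_vec M. euclid_norm v = 1}
     = (\<lambda>x. vnorm M (mv M (entries A) x)) ` {x. vnorm M x = 1}" (is "?L = ?R")
  proof (intro equalityI subsetI)
    fix y assume "y \<in> ?L"
    then obtain v where v: "v \<in> carrier_vec M" "euclid_norm v = 1" "y = euclid_norm (A *\<^sub>v v)" by auto
    then show "y \<in> ?R" by (intro image_eqI[of _ _ "\<lambda>j. v $ j"]) (auto simp: e euclid_norm_eq)
  next
    fix y assume "y \<in> ?R"
    then obtain x where x: "vnorm M x = 1" "y = vnorm M (mv M (entries A) x)" by auto
    have c: "vec M x \<in> carrier_vec M" by simp
    have 1: "vnorm M (\<lambda>i. vec M x $ i) = vnorm M x" by (rule L2_set_cong) auto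
    have 2: "mv M (entries A) (\<lambda>j. vec M x $ j) = mv M (entries A) x"
      unfolding mv_def by (intro ext sum.cong) auto
    show "y \<in> ?L" by (intro image_eqI[of _ _ "vec M x"]) (use x in \<open>simp_all add: e[OF c] euclid_norm_eq[OF c] 1 2\<close>)
  qed
  then show ?thesis using A unfolding spectral_norm_def opn_def by simp
qed

lemma hs_norm_rank1_mult:
  assumes X: "X \<in> carrier_mat M M" and u: "vnorm M u = 1"
  shows "(hs_norm (rank1 M u * X))\<^sup>2 = (vnorm M (mv M (tmat (entries X)) u))\<^sup>2"
proof -
  have ent: "(rank1 M u * X) $$ (i, j) = u i * mv M (tmat (entries X)) u j" if "i < M" "j < M" for i j
    using X that by (auto simp: rank1_def mv_def tmat_def entries_def scalar_prod_def lessThan_atLeast0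
        sum_distrib_left mult_ac intro!: sum.cong)
  have d: "dim_row (rank1 M u * X) = M" "dim_col (rank1 M u * X) = M" using X by (auto simp: rank1_def)
  have "(hs_norm (rank1 M u * X))\<^sup>2 = (\<Sum>i<M. \<Sum>j<M. ((rank1 M u * X) $$ (i, j))\<^sup>2)"
    unfolding hs_norm_def d by (simp add: sum_nonneg)
  also have "\<dots> = (\<Sum>i<M. \<Sum>j<M. (u i)\<^sup>2 * (mv M (tmat (entries X)) u j)\<^sup>2)"
    by (intro sum.cong refl) (simp add: ent power_mult_distrib)
  also have "\<dots> = (vnorm M u)\<^sup>2 * (vnorm M (mv M (tmat (entries X)) u))\<^sup>2"
    unfolding vnorm_sq by (simp add: sum_product)
  finally show ?thesis using u by simp
qed

text \<open>A subspace of dimension one is the set of multiples of some \<open>b \<noteq> 0\<close>, and normalizing \<open>b\<close> gives \<open>u\<close>. The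
  dimension is a least cardinality of finite generating sets, which says nothing unless one such set
  exists; for the image of an orthogonal projection the columns of the projection are one.\<close>

lemma orth_projs_1: "orth_projs M 1 = {rank1 M u | u. vnorm M u = 1}"
proof -
  interpret vec_space "TYPE(real)" M .
  let ?W = "\<lambda>S. V\<lparr>carrier := S\<rparr>"
  have span_single: "span {b} = {c \<cdot>\<^sub>v b | c. True}" if b: "b \<in> carrier_vec M" for b :: "real vec"
  proof -
    have lc: "lincomb a {b} = a b \<cdot>\<^sub>v b" for a
      using b by (simp add: lincomb_def)
    have "span {b} = {lincomb a {b} | a. True}" using finite_span[of "{b}"] b by auto
    also have "\<dots> = {c \<cdot>\<^sub>v b | c. True}"
    proof (intro equalityI subsetI)
      fix y assume "y \<in> {c \<cdot>\<^sub>v b | c. True}"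
      then obtain c where "y = c \<cdot>\<^sub>v b" by auto
      then have "y = lincomb (\<lambda>_. c) {b}" using lc by simp
      then show "y \<in> {lincomb a {b} | a. True}" by blast
    qed (auto simp: lc)
    finally show ?thesis .
  qed
  have rank1_mult_vec: "rank1 M u *\<^sub>v v = (vec M u \<bullet> v) \<cdot>\<^sub>v vec M u" if "v \<in> carrier_vec M" for u :: "nat \<Rightarrow> real" and v
    by (rule eq_vecI) (use that in \<open>auto simp: rank1_def scalar_prod_def sum_distrib_left mult_ac intro!: sum.cong\<close>)
  show ?thesis
  proof (intro equalityI subsetI)
    fix P assume "P \<in> orth_projs M 1"
    then obtain S where sub: "VectorSpace.subspace class_ring S V"
      and dim1: "vectorspace.dim class_ring (?W S) = 1" and P: "is_orth_proj_onto M S P"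
      unfolding orth_projs_def by auto
    have PM: "P \<in> carrier_mat M M" using P by (simp add: is_orth_proj_onto_def)
    have SM: "S \<subseteq> carrier_vec M" and sm: "submodule class_ring S V"
      using sub by (auto simp: VectorSpace.subspace_def submodule_def)
    interpret W: vectorspace class_ring "?W S" by (rule subspace_is_vs[OF sub])
    have inS: "P *\<^sub>v v \<in> S" if "v \<in> carrier_vec M" for v using P that by (simp add: is_orth_proj_onto_def)
    have orth: "(v - P *\<^sub>v v) \<bullet> w = 0" if "v \<in> carrier_vec M" "w \<in> S" for v w
      using P that by (simp add: is_orth_proj_onto_def)
    have fixS: "P *\<^sub>v w = w" if w: "w \<in> S" for w
    proof -
      have wM: "w \<in> carrier_vec M" using w SM by auto
      let ?d = "w - P *\<^sub>v w"
      have dM: "?d \<in> carrier_vec M" using wM PM by auto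
      have "?d \<bullet> ?d = ?d \<bullet> w - ?d \<bullet> (P *\<^sub>v w)"
        using dM wM PM by (intro scalar_prod_minus_distrib) auto
      also have "\<dots> = 0" using orth[OF wM w] orth[OF wM inS[OF wM]] by simp
      finally have d0: "?d = 0\<^sub>v M" using dM by (simp add: conjugate_square_eq_0_vec[symmetric] flip: conjugate_id)
      have "w $ i - (P *\<^sub>v w) $ i = 0" if "i < M" for i
      proof -
        have "?d $ i = 0" unfolding d0 using that by simp
        then show ?thesis using that wM PM by simp
      qed
      then show ?thesis using wM PM by (intro eq_vecI) auto
    qed
    have SP: "S = span (set (cols P))"
      unfolding col_space_def[symmetric] col_space_eq[OF PM] using fixS inS SM PM by force
    \<comment> \<open>the generating set that makes the dimension meaningful\<close>
    have "W.fin_dim" using fin_dim_span_cols[OF PM] unfolding SP .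
    then have "\<exists>n A. finite A \<and> card A = n \<and> A \<subseteq> carrier (?W S) \<and> W.gen_set A"
      unfolding W.fin_dim_def by auto
    then have "\<exists>A. finite A \<and> card A = W.dim \<and> A \<subseteq> carrier (?W S) \<and> W.gen_set A"
      unfolding W.dim_def by (rule LeastI_ex)
    then obtain A where A: "finite A" "card A = 1" "A \<subseteq> S" "W.span A = S" unfolding dim1 by auto
    then obtain b where b: "A = {b}" by (auto simp: card_1_singleton_iff)
    have bM: "b \<in> carrier_vec M" using A b SM by auto
    have Sb: "S = {c \<cdot>\<^sub>v b | c. True}"
      using span_li_not_depend(1)[OF A(3) sm] A(4) span_single[OF bM] b by simp
    have b0: "b \<noteq> 0\<^sub>v M"
    proof
      assume z: "b = 0\<^sub>v M"
      have "S = {0\<^sub>v M}" unfolding Sb z by auto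
      then have "W.span {} = S" using W.span_empty by (simp add: module_vec_simps)
      then have "W.dim \<le> 0"
        unfolding W.dim_def by (intro Least_le exI[of _ "{}"]) auto
      then show False using dim1 by simp
    qed
    define k where "k = vnorm M (\<lambda>i. b $ i)"
    have bb: "b \<bullet> b = k\<^sup>2"
      using bM unfolding k_def vnorm_sq by (auto simp: scalar_prod_def power2_eq_square lessThan_atLeast0)
    have k: "k > 0"
    proof -
      have "k \<noteq> 0"
      proof
        assume "k = 0"
        then have "b = 0\<^sub>v M" using bM unfolding k_def by (intro eq_vecI) (auto dest: vnorm_eq_0)
        then show False using b0 by simp
      qed
      then show ?thesis unfolding k_def by (metis L2_set_nonneg le_less)
    qed
    define u where "u = (\<lambda>i. (1 / k) * b $ i)"
    have uv: "vec M u = (1 / k) \<cdot>\<^sub>v b" using bM by (intro eq_vecI) (auto simp: u_def)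
    have u1: "vnorm M u = 1" unfolding u_def vnorm_scale k_def[symmetric] using k by simp
    have Pv: "P *\<^sub>v v = rank1 M u *\<^sub>v v" if v: "v \<in> carrier_vec M" for v
    proof -
      obtain c where c: "P *\<^sub>v v = c \<cdot>\<^sub>v b" using inS[OF v] unfolding Sb by auto
      have "b \<in> S" using A b by auto
      then have "v \<bullet> b - (c \<cdot>\<^sub>v b) \<bullet> b = 0"
        using orth[OF v \<open>b \<in> S\<close>] v bM unfolding c by (simp add: minus_scalar_prod_distrib[of _ M])
      then have "c = (b \<bullet> v) / k\<^sup>2" using bM v k bb by (simp add: comm_scalar_prod[of v M b] field_simps)
      then show ?thesis unfolding rank1_mult_vec[OF v] uv c using bM v k by (simp add: smult_smult_assoc power2_eq_square)
    qed
    have "P = rank1 M u"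
    proof (rule eq_matI)
      have col: "(Q *\<^sub>v unit_vec M j) $ i = Q $$ (i, j)" if "Q \<in> carrier_mat M M" "i < M" "j < M" for Q :: "real mat" and i j
        using that by (auto simp: scalar_prod_right_unit[of j M])
      have RM: "rank1 M u \<in> carrier_mat M M" by (simp add: rank1_def)
      fix i j assume ij: "i < dim_row (rank1 M u)" "j < dim_col (rank1 M u)"
      then have "i < M" "j < M" by (auto simp: rank1_def)
      then show "P $$ (i, j) = rank1 M u $$ (i, j)"
        using col[OF PM, of i j] col[OF RM, of i j] by (simp add: Pv)
    qed (use PM in \<open>auto simp: rank1_def\<close>)
    then show "P \<in> {rank1 M u | u. vnorm M u = 1}" using u1 by blast
  next
    fix P assume "P \<in> {rank1 M u | u. vnorm M u = 1}"
    then obtain u where u: "vnorm M u = 1" and P: "P = rank1 M u" by auto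
    define b where "b = vec M u"
    have bM: "b \<in> carrier_vec M" by (simp add: b_def)
    have bb: "b \<bullet> b = 1"
      using u vnorm_sq[of u M] by (auto simp: b_def scalar_prod_def power2_eq_square lessThan_atLeast0)
    have b0: "b \<noteq> 0\<^sub>v M" using bb bM by auto
    define S where "S = span {b}"
    have Sb: "S = {c \<cdot>\<^sub>v b | c. True}" unfolding S_def by (rule span_single[OF bM])
    have sub: "VectorSpace.subspace class_ring S V" unfolding S_def by (rule span_is_subspace) (use bM in auto)
    have sm: "submodule class_ring S V" using sub by (auto simp: VectorSpace.subspace_def)
    interpret W: vectorspace class_ring "?W S" by (rule subspace_is_vs[OF sub])
    have bS: "b \<in> S" unfolding Sb using bM by (intro CollectI exI[of _ 1]) auto
    have gen: "W.span {b} = S" using span_li_not_depend(1)[OF _ sm, of "{b}"] bS S_def by simp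
    have "W.dim = 1"
      unfolding W.dim_def
    proof (rule Least_equality)
      show "\<exists>A. finite A \<and> card A = 1 \<and> A \<subseteq> carrier (?W S) \<and> W.gen_set A"
        by (rule exI[of _ "{b}"]) (use bS gen in auto)
      fix n assume "\<exists>A. finite A \<and> card A = n \<and> A \<subseteq> carrier (?W S) \<and> W.gen_set A"
      then obtain A where A: "finite A" "card A = n" "W.span A = S" by auto
      show "1 \<le> n"
      proof (rule ccontr)
        assume "\<not> 1 \<le> n"
        then have "A = {}" using A(1,2) by (metis card_0_eq less_one linorder_not_le)
        then have "S = {0\<^sub>v M}" using A(3) W.span_empty by (simp add: module_vec_simps)
        then show False using bS b0 by auto
      qed
    qed
    moreover have "is_orth_proj_onto M S P"
      unfolding is_orth_proj_onto_def P
    proof (intro conjI ballI)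
      show "rank1 M u \<in> carrier_mat M M" by (simp add: rank1_def)
      fix v :: "real vec" assume v: "v \<in> carrier_vec M"
      show "rank1 M u *\<^sub>v v \<in> S" unfolding rank1_mult_vec[OF v] Sb b_def by auto
      fix w assume "w \<in> S"
      then obtain c where w: "w = c \<cdot>\<^sub>v b" unfolding Sb by auto
      show "(v - rank1 M u *\<^sub>v v) \<bullet> w = 0"
        unfolding rank1_mult_vec[OF v] b_def[symmetric] w using v bM bb
        by (simp add: minus_scalar_prod_distrib[of _ M] comm_scalar_prod[of v M b])
    qed
    ultimately show "P \<in> orth_projs M 1" using sub unfolding orth_projs_def by auto
  qed
qed

lemma arg_max_on_value:
  fixes f :: "'a \<Rightarrow> real"
  assumes "x \<in> S" "\<And>y. y \<in> S \<Longrightarrow> f y \<le> f x"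
  shows "f (arg_max_on f S) = f x"
proof -
  have "is_arg_max f (\<lambda>x. x \<in> S) (arg_max_on f S)"
    unfolding arg_max_on_def arg_max_def
    by (rule someI[of _ x]) (use assms in \<open>auto simp: is_arg_max_def not_less\<close>)
  then have "arg_max_on f S \<in> S" "f x \<le> f (arg_max_on f S)"
    using assms(1) unfolding is_arg_max_def by (auto simp: not_less)
  then show ?thesis using assms(2) by (intro antisym) auto
qed

text \<open>The choice of maximizer is irrelevant because the maximum over all \<open>u u\<^sup>T\<close> is attained, and equals
  \<open>\<parallel>X\<^sup>T\<parallel>\<^sup>2 = \<parallel>X\<parallel>\<^sup>2\<close>.\<close>

lemma hs_norm_pi_hat:
  assumes M: "0 < M" and X: "X \<in> carrier_mat M M"
  shows "(hs_norm (pi_hat M 1 X * X))\<^sup>2 = (opn M (entries X))\<^sup>2"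
proof -
  let ?T = "tmat (entries X)"
  obtain u where u: "vnorm M u = 1" "vnorm M (mv M ?T u) = opn M ?T"
    using opn_attained[OF M] by blast
  have "(hs_norm (pi_hat M 1 X * X))\<^sup>2 = (hs_norm (rank1 M u * X))\<^sup>2"
    unfolding pi_hat_def
  proof (rule arg_max_on_value)
    show "rank1 M u \<in> orth_projs M 1" using u unfolding orth_projs_1 by auto
    fix P assume "P \<in> orth_projs M 1"
    then obtain w where w: "vnorm M w = 1" "P = rank1 M w" unfolding orth_projs_1 by auto
    show "(hs_norm (P * X))\<^sup>2 \<le> (hs_norm (rank1 M u * X))\<^sup>2"
      unfolding w(2) hs_norm_rank1_mult[OF X w(1)] hs_norm_rank1_mult[OF X u(1)] u(2)
      using vnorm_mv_le[OF M, of ?T w] w(1) by (intro power_mono) auto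
  qed
  then show ?thesis by (simp only: hs_norm_rank1_mult[OF X u(1)] u(2) opn_tmat[OF M])
qed

section \<open>Moments of Gaussian linear forms\<close>

text \<open>The sign patterns are those with product \<open>+1\<close>; linear terms and mixed products cancel. Each half of the
  polarization sum in \<open>wick4\<close> has this form.\<close>

lemma four_signs:
  fixes A x y z :: real
  shows "(A + 2 * (x + y + z))\<^sup>2 + (A + 2 * (x - y - z))\<^sup>2 + (A + 2 * (y - x - z))\<^sup>2 + (A + 2 * (z - x - y))\<^sup>2
     = 4 * A\<^sup>2 + 16 * (x\<^sup>2 + y\<^sup>2 + z\<^sup>2)"
  by (simp add: power2_eq_square algebra_simps)

locale gauss_family = prob_space \<Omega> for \<Omega> :: "'w measure" +
  fixes I :: "'i set" and X :: "'i \<Rightarrow> 'w \<Rightarrow> real" and s :: real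
  assumes fin: "finite I" and s_pos: "0 < s"
    and indep: "indep_vars (\<lambda>_. borel) X I"
    and normal: "\<And>i. i \<in> I \<Longrightarrow> distributed \<Omega> lborel (X i) (normal_density 0 s)"
begin

definition lin :: "('i \<Rightarrow> real) \<Rightarrow> 'w \<Rightarrow> real" where
  "lin a \<omega> = (\<Sum>i\<in>I. a i * X i \<omega>)"

definition ip :: "('i \<Rightarrow> real) \<Rightarrow> ('i \<Rightarrow> real) \<Rightarrow> real" where
  "ip a b = (\<Sum>i\<in>I. a i * b i)"

lemma ip_self_nonneg: "0 \<le> ip a a"
  by (simp add: ip_def sum_nonneg)

lemma X_measurable: "i \<in> I \<Longrightarrow> X i \<in> borel_measurable \<Omega>"
  using distributed_measurable[OF normal] by simp

lemma lin_measurable [measurable]: "lin a \<in> borel_measurable \<Omega>"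
  unfolding lin_def by (intro borel_measurable_sum borel_measurable_times X_measurable) auto

lemma lin_degenerate: "ip a a = 0 \<Longrightarrow> lin a \<omega> = 0"
  unfolding ip_def lin_def by (subst (asm) sum_nonneg_eq_0_iff[OF fin]) (auto intro: sum.neutral)

text \<open>Zero coefficients are dropped first, because the closure rule for independent normal variables asks for
  positive variances of all summands.\<close>

lemma lin_distributed:
  assumes "0 < ip a a"
  shows "distributed \<Omega> lborel (lin a) (normal_density 0 (s * sqrt (ip a a)))"
proof -
  define J where "J = {i \<in> I. a i \<noteq> 0}"
  have J: "finite J" "J \<subseteq> I" using fin by (auto simp: J_def)
  have ne: "J \<noteq> {}" using assms by (auto simp: J_def ip_def intro: ccontr)
  have ind: "indep_vars (\<lambda>_. borel) (\<lambda>i \<omega>. a i * X i \<omega>) J"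
    by (rule indep_vars_compose2[OF indep_vars_subset[OF indep J(2)], where Y = "\<lambda>i x. a i * x"]) simp
  have nrm: "distributed \<Omega> lborel (\<lambda>\<omega>. a i * X i \<omega>) (normal_density 0 (\<bar>a i\<bar> * s))" if "i \<in> J" for i
    using normal_density_affine[OF normal s_pos, of i "a i" 0] that by (auto simp: J_def)
  have "distributed \<Omega> lborel (\<lambda>\<omega>. \<Sum>i\<in>J. a i * X i \<omega>)
      (normal_density (\<Sum>i\<in>J. 0) (sqrt (\<Sum>i\<in>J. (\<bar>a i\<bar> * s)\<^sup>2)))"
    by (rule sum_indep_normal[OF J(1) ne ind _ nrm]) (use s_pos in \<open>auto simp: J_def\<close>)
  moreover have "(\<Sum>i\<in>J. (\<bar>a i\<bar> * s)\<^sup>2) = s\<^sup>2 * ip a a"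
  proof -
    have "(\<Sum>i\<in>J. (\<bar>a i\<bar> * s)\<^sup>2) = (\<Sum>i\<in>I. (\<bar>a i\<bar> * s)\<^sup>2)"
      by (rule sum.mono_neutral_left) (use fin in \<open>auto simp: J_def\<close>)
    then show ?thesis by (simp add: ip_def sum_distrib_left power_mult_distrib power2_eq_square mult_ac)
  qed
  moreover have "(\<Sum>i\<in>J. a i * X i \<omega>) = lin a \<omega>" for \<omega>
    unfolding lin_def by (rule sum.mono_neutral_left) (use fin in \<open>auto simp: J_def\<close>)
  ultimately show ?thesis using s_pos by (simp add: real_sqrt_mult)
qed

text \<open>Moments of \<open>lin a\<close> are integrals against a normal density. Stating integrability and value together
  as \<open>has_bochner_integral\<close> lets the polynomial identities below be integrated term by term.\<close>

lemma lin_transfer: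
  assumes "0 < ip a a" "g \<in> borel_measurable borel"
    and "has_bochner_integral lborel (\<lambda>x. normal_density 0 (s * sqrt (ip a a)) x * g x) c"
  shows "has_bochner_integral \<Omega> (\<lambda>\<omega>. g (lin a \<omega>)) (c :: real)"
proof -
  note D = lin_distributed[OF assms(1)]
  have "integrable \<Omega> (\<lambda>\<omega>. g (lin a \<omega>))"
    using distributed_integrable[OF D, of g] assms(2,3) by (auto simp: has_bochner_integral_iff)
  moreover have "(\<integral>\<omega>. g (lin a \<omega>) \<partial>\<Omega>) = c"
    using distributed_integral[OF D, of g] assms(2,3) by (auto simp: has_bochner_integral_iff)
  ultimately show ?thesis by (simp add: has_bochner_integral_iff)
qed

lemma lin_odd_moment: "has_bochner_integral \<Omega> (\<lambda>\<omega>. lin a \<omega> ^ (2 * k + 1)) 0"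
proof (cases "ip a a = 0")
  case False
  then have pos: "0 < ip a a" using ip_self_nonneg[of a] by linarith
  then have "0 < s * sqrt (ip a a)" using s_pos by simp
  from normal_moment_odd[OF this, of 0 k] show ?thesis
    using pos by (intro lin_transfer) auto
qed (simp add: lin_degenerate has_bochner_integral_zero)

lemma lin_even_moment:
  assumes "0 < k"
  shows "has_bochner_integral \<Omega> (\<lambda>\<omega>. lin a \<omega> ^ (2 * k)) (fact (2 * k) / (2 ^ k * fact k) * (s\<^sup>2 * ip a a) ^ k)"
proof (cases "ip a a = 0")
  case False
  then have pos: "0 < ip a a" using ip_self_nonneg[of a] by linarith
  then have sp: "0 < s * sqrt (ip a a)" using s_pos by simp
  have "fact (2 * k) / ((2 / (s * sqrt (ip a a))\<^sup>2) ^ k * fact k) = fact (2 * k) / (2 ^ k * fact k) * (s\<^sup>2 * ip a a) ^ k"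
    using pos s_pos by (simp add: power_mult_distrib power_divide field_simps)
  with normal_moment_even[OF sp, of 0 k] show ?thesis
    using pos by (intro lin_transfer) auto
qed (use assms in \<open>simp add: lin_degenerate power_0_left has_bochner_integral_zero\<close>)

lemma lin_mean: "has_bochner_integral \<Omega> (lin a) 0"
  using lin_odd_moment[of a 0] by simp

lemma lin_square: "has_bochner_integral \<Omega> (\<lambda>\<omega>. lin a \<omega> ^ 2) (s\<^sup>2 * ip a a)"
  using lin_even_moment[of 1 a] by simp

lemma lin_cube: "has_bochner_integral \<Omega> (\<lambda>\<omega>. lin a \<omega> ^ 3) 0"
  using lin_odd_moment[of a 1] by (simp add: numeral_3_eq_3)

lemma lin_fourth: "has_bochner_integral \<Omega> (\<lambda>\<omega>. lin a \<omega> ^ 4) (3 * (s\<^sup>2 * ip a a)\<^sup>2)"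
  using lin_even_moment[of 2 a] by (simp add: fact_numeral)

lemma lin_add: "lin (\<lambda>i. a i + b i) \<omega> = lin a \<omega> + lin b \<omega>"
  by (simp add: lin_def sum.distrib distrib_right)

lemma lin_scale: "lin (\<lambda>i. c * a i) \<omega> = c * lin a \<omega>"
  by (simp add: lin_def sum_distrib_left mult.assoc)

lemma ip_add_left: "ip (\<lambda>i. a i + b i) c = ip a c + ip b c"
  by (simp add: ip_def sum.distrib distrib_right)

lemma ip_scale_left: "ip (\<lambda>i. k * a i) c = k * ip a c"
  by (simp add: ip_def sum_distrib_left mult.assoc)

lemma ip_commute: "ip a b = ip b a"
  by (simp add: ip_def mult.commute)

lemma ip_add_right: "ip c (\<lambda>i. a i + b i) = ip c a + ip c b"
  by (simp add: ip_def sum.distrib distrib_left)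

lemma ip_scale_right: "ip c (\<lambda>i. k * a i) = k * ip c a"
  by (simp add: ip_def sum_distrib_left mult.left_commute)

text \<open>The moments of products of linear forms follow by polarization from the moments of a single form,
  since sums of linear forms are linear forms again, and a single form has a one-dimensional normal
  distribution.\<close>

lemma wick2: "has_bochner_integral \<Omega> (\<lambda>\<omega>. lin a \<omega> * lin b \<omega>) (s\<^sup>2 * ip a b)"
proof -
  have "has_bochner_integral \<Omega> (\<lambda>\<omega>. (lin (\<lambda>i. a i + b i) \<omega> ^ 2 - lin a \<omega> ^ 2 - lin b \<omega> ^ 2) * (1/2))
     ((s\<^sup>2 * ip (\<lambda>i. a i + b i) (\<lambda>i. a i + b i) - s\<^sup>2 * ip a a - s\<^sup>2 * ip b b) * (1/2))"
    by (intro has_bochner_integral_mult_left has_bochner_integral_diff lin_square)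
  moreover have "(lin (\<lambda>i. a i + b i) \<omega> ^ 2 - lin a \<omega> ^ 2 - lin b \<omega> ^ 2) * (1/2) = lin a \<omega> * lin b \<omega>" for \<omega>
    by (simp add: lin_add power2_sum)
  moreover have "(s\<^sup>2 * ip (\<lambda>i. a i + b i) (\<lambda>i. a i + b i) - s\<^sup>2 * ip a a - s\<^sup>2 * ip b b) * (1/2) = s\<^sup>2 * ip a b"
    by (simp add: ip_add_left ip_add_right ip_commute[of b a] algebra_simps)
  ultimately show ?thesis by simp
qed

lemma wick3: "has_bochner_integral \<Omega> (\<lambda>\<omega>. lin a \<omega> * lin b \<omega> * lin c \<omega>) 0"
proof -
  define p where "p e f = (\<lambda>i. a i + (e * b i + f * c i))" for e f :: real
  have p: "lin (p e f) \<omega> = lin a \<omega> + (e * lin b \<omega> + f * lin c \<omega>)" for e f \<omega>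
    by (simp add: p_def lin_add lin_scale)
  have "has_bochner_integral \<Omega> (\<lambda>\<omega>. (lin (p 1 1) \<omega> ^ 3 - lin (p 1 (-1)) \<omega> ^ 3 - lin (p (-1) 1) \<omega> ^ 3
      + lin (p (-1) (-1)) \<omega> ^ 3) * (1/24)) ((0 - 0 - 0 + 0) * (1/24))"
    by (intro has_bochner_integral_mult_left has_bochner_integral_diff has_bochner_integral_add lin_cube)
  moreover have "(lin (p 1 1) \<omega> ^ 3 - lin (p 1 (-1)) \<omega> ^ 3 - lin (p (-1) 1) \<omega> ^ 3
      + lin (p (-1) (-1)) \<omega> ^ 3) * (1/24) = lin a \<omega> * lin b \<omega> * lin c \<omega>" for \<omega>
    unfolding p by (simp add: power3_eq_cube algebra_simps)
  ultimately show ?thesis by simp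
qed

text \<open>Isserlis' formula. The products of four forms are recovered from the fourth powers of
  \<open>a \<plusminus> b \<plusminus> c \<plusminus> d\<close>, taken with the product of the signs; \<open>192 = 8 * 4!\<close>. The squared variances
  of the eight combinations are grouped by the product of the signs and summed with \<open>four_signs\<close>.\<close>

lemma wick4: "has_bochner_integral \<Omega> (\<lambda>\<omega>. lin a \<omega> * lin b \<omega> * lin c \<omega> * lin d \<omega>)
   (s ^ 4 * (ip a b * ip c d + ip a c * ip b d + ip a d * ip b c))"
proof -
  define p where "p e f g = (\<lambda>i. a i + (e * b i + (f * c i + g * d i)))" for e f g :: real
  have p: "lin (p e f g) \<omega> = lin a \<omega> + (e * lin b \<omega> + (f * lin c \<omega> + g * lin d \<omega>))" for e f g \<omega>
    by (simp add: p_def lin_add lin_scale)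
  define q where "q e f g = 3 * (s\<^sup>2 * ip (p e f g) (p e f g))\<^sup>2" for e f g
  have ipp: "ip (p e f g) (p e f g) = ip a a + e\<^sup>2 * ip b b + f\<^sup>2 * ip c c + g\<^sup>2 * ip d d
     + 2 * (e * ip a b + f * ip a c + g * ip a d + e * f * ip b c + e * g * ip b d + f * g * ip c d)" for e f g
    unfolding p_def ip_add_left ip_add_right ip_scale_left ip_scale_right
    by (simp add: ip_commute[of b a] ip_commute[of c a] ip_commute[of d a] ip_commute[of c b]
        ip_commute[of d b] ip_commute[of d c] power2_eq_square algebra_simps)
  have "has_bochner_integral \<Omega> (\<lambda>\<omega>. (lin (p 1 1 1) \<omega> ^ 4 + lin (p 1 (-1) (-1)) \<omega> ^ 4 + lin (p (-1) 1 (-1)) \<omega> ^ 4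
      + lin (p (-1) (-1) 1) \<omega> ^ 4 - lin (p (-1) (-1) (-1)) \<omega> ^ 4 - lin (p (-1) 1 1) \<omega> ^ 4
      - lin (p 1 (-1) 1) \<omega> ^ 4 - lin (p 1 1 (-1)) \<omega> ^ 4) * (1/192))
      ((q 1 1 1 + q 1 (-1) (-1) + q (-1) 1 (-1) + q (-1) (-1) 1 - q (-1) (-1) (-1) - q (-1) 1 1
        - q 1 (-1) 1 - q 1 1 (-1)) * (1/192))"
    unfolding q_def
    by (intro has_bochner_integral_mult_left has_bochner_integral_diff has_bochner_integral_add lin_fourth)
  moreover have "(lin (p 1 1 1) \<omega> ^ 4 + lin (p 1 (-1) (-1)) \<omega> ^ 4 + lin (p (-1) 1 (-1)) \<omega> ^ 4
      + lin (p (-1) (-1) 1) \<omega> ^ 4 - lin (p (-1) (-1) (-1)) \<omega> ^ 4 - lin (p (-1) 1 1) \<omega> ^ 4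
      - lin (p 1 (-1) 1) \<omega> ^ 4 - lin (p 1 1 (-1)) \<omega> ^ 4) * (1/192)
      = lin a \<omega> * lin b \<omega> * lin c \<omega> * lin d \<omega>" for \<omega>
    unfolding p by (simp add: power4_eq_xxxx algebra_simps)
  moreover have "(q 1 1 1 + q 1 (-1) (-1) + q (-1) 1 (-1) + q (-1) (-1) 1 - q (-1) (-1) (-1) - q (-1) 1 1
        - q 1 (-1) 1 - q 1 1 (-1)) * (1/192) = s ^ 4 * (ip a b * ip c d + ip a c * ip b d + ip a d * ip b c)"
  proof -
    define A where "A = ip a a + ip b b + ip c c + ip d d"
    define x x' y y' z z' where "x = ip a b + ip c d" and "x' = ip c d - ip a b"
      and "y = ip a c + ip b d" and "y' = ip b d - ip a c" and "z = ip a d + ip b c" and "z' = ip b c - ip a d"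
    note defs = A_def x_def x'_def y_def y'_def z_def z'_def
    have q': "q e f g = 3 * s ^ 4 * (ip (p e f g) (p e f g))\<^sup>2" for e f g
      by (simp add: q_def power_mult_distrib)
    have 1: "ip (p 1 1 1) (p 1 1 1) = A + 2 * (x + y + z)"
      "ip (p 1 (-1) (-1)) (p 1 (-1) (-1)) = A + 2 * (x - y - z)"
      "ip (p (-1) 1 (-1)) (p (-1) 1 (-1)) = A + 2 * (y - x - z)"
      "ip (p (-1) (-1) 1) (p (-1) (-1) 1) = A + 2 * (z - x - y)"
      by (simp_all add: ipp defs)
    have 2: "ip (p (-1) (-1) (-1)) (p (-1) (-1) (-1)) = A + 2 * (x' + y' + z')"
      "ip (p (-1) 1 1) (p (-1) 1 1) = A + 2 * (x' - y' - z')"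
      "ip (p 1 (-1) 1) (p 1 (-1) 1) = A + 2 * (y' - x' - z')"
      "ip (p 1 1 (-1)) (p 1 1 (-1)) = A + 2 * (z' - x' - y')"
      by (simp_all add: ipp defs)
    have "(q 1 1 1 + q 1 (-1) (-1) + q (-1) 1 (-1) + q (-1) (-1) 1 - q (-1) (-1) (-1) - q (-1) 1 1
        - q 1 (-1) 1 - q 1 1 (-1)) = 3 * s ^ 4 *
        (((A + 2 * (x + y + z))\<^sup>2 + (A + 2 * (x - y - z))\<^sup>2 + (A + 2 * (y - x - z))\<^sup>2 + (A + 2 * (z - x - y))\<^sup>2)
        - ((A + 2 * (x' + y' + z'))\<^sup>2 + (A + 2 * (x' - y' - z'))\<^sup>2 + (A + 2 * (y' - x' - z'))\<^sup>2 + (A + 2 * (z' - x' - y'))\<^sup>2))"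
      unfolding q' 1 2 by (simp only: right_diff_distrib distrib_left diff_diff_eq add.assoc)
    also have "\<dots> = 48 * s ^ 4 * ((x\<^sup>2 - x'\<^sup>2) + (y\<^sup>2 - y'\<^sup>2) + (z\<^sup>2 - z'\<^sup>2))"
      unfolding four_signs by (simp add: algebra_simps)
    also have "(x\<^sup>2 - x'\<^sup>2) + (y\<^sup>2 - y'\<^sup>2) + (z\<^sup>2 - z'\<^sup>2) = 4 * (ip a b * ip c d + ip a c * ip b d + ip a d * ip b c)"
      by (simp add: defs power2_eq_square algebra_simps)
    finally show ?thesis by simp
  qed
  ultimately show ?thesis by simp
qed

text \<open>With \<open>\<tau>\<^sup>2\<close> the variance, multiplying the density of variance \<open>\<tau>\<^sup>2\<close> by \<open>exp (x\<^sup>2 / (4 \<tau>\<^sup>2))\<close> gives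
  \<open>\<surd>2\<close> times the density of variance \<open>2 \<tau>\<^sup>2\<close>, so the exponential moment is \<open>\<surd>2\<close>. The bound \<open>ip a a \<le> 4\<close>
  is the one that grid vectors satisfy, and it means \<open>4 \<tau>\<^sup>2 \<le> 16 s\<^sup>2\<close>.\<close>

lemma lin_exp_square:
  assumes "ip a a \<le> 4"
  shows "integrable \<Omega> (\<lambda>\<omega>. exp ((lin a \<omega>)\<^sup>2 / (16 * s\<^sup>2)))"
    and "(\<integral>\<omega>. exp ((lin a \<omega>)\<^sup>2 / (16 * s\<^sup>2)) \<partial>\<Omega>) \<le> 2"
proof -
  have "integrable \<Omega> (\<lambda>\<omega>. exp ((lin a \<omega>)\<^sup>2 / (16 * s\<^sup>2))) \<and> (\<integral>\<omega>. exp ((lin a \<omega>)\<^sup>2 / (16 * s\<^sup>2)) \<partial>\<Omega>) \<le> 2"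
  proof (cases "ip a a = 0")
    case True
    then show ?thesis by (simp add: lin_degenerate prob_space)
  next
    case False
    then have pos: "0 < ip a a" using ip_self_nonneg[of a] by linarith
    define \<tau> where "\<tau> = s * sqrt (ip a a)"
    have \<tau>: "0 < \<tau>" "\<tau>\<^sup>2 = s\<^sup>2 * ip a a" using pos s_pos by (auto simp: \<tau>_def power_mult_distrib)
    have eq: "normal_density 0 \<tau> x * exp (x\<^sup>2 / (4 * \<tau>\<^sup>2)) = normal_density 0 (sqrt 2 * \<tau>) x * sqrt 2" for x
    proof -
      have "exp (- (x\<^sup>2 / (2 * \<tau>\<^sup>2))) * exp (x\<^sup>2 / (4 * \<tau>\<^sup>2)) = exp (- (x\<^sup>2 / (4 * \<tau>\<^sup>2)))"
        unfolding exp_add[symmetric] by (simp add: field_simps)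
      then show ?thesis using \<tau>(1)
        by (simp add: normal_density_def power_mult_distrib real_sqrt_mult field_simps)
    qed
    have "has_bochner_integral lborel (\<lambda>x. normal_density 0 (sqrt 2 * \<tau>) x * sqrt 2) (1 * sqrt 2)"
      using \<tau>(1) by (intro has_bochner_integral_mult_left) (simp add: has_bochner_integral_iff)
    then have "has_bochner_integral lborel (\<lambda>x. normal_density 0 \<tau> x * exp (x\<^sup>2 / (4 * \<tau>\<^sup>2))) (sqrt 2)"
      unfolding eq by simp
    then have 1: "has_bochner_integral \<Omega> (\<lambda>\<omega>. exp ((lin a \<omega>)\<^sup>2 / (4 * \<tau>\<^sup>2))) (sqrt 2)"
      by (intro lin_transfer pos) (auto simp: \<tau>_def)
    have le: "exp ((lin a \<omega>)\<^sup>2 / (16 * s\<^sup>2)) \<le> exp ((lin a \<omega>)\<^sup>2 / (4 * \<tau>\<^sup>2))" for \<omega>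
      using assms pos s_pos by (auto simp: \<tau>(2) intro!: divide_left_mono)
    have int: "integrable \<Omega> (\<lambda>\<omega>. exp ((lin a \<omega>)\<^sup>2 / (16 * s\<^sup>2)))"
      by (rule Bochner_Integration.integrable_bound[where f = "\<lambda>\<omega>. exp ((lin a \<omega>)\<^sup>2 / (4 * \<tau>\<^sup>2))"])
        (use 1 le in \<open>auto simp: has_bochner_integral_iff\<close>)
    have "(\<integral>\<omega>. exp ((lin a \<omega>)\<^sup>2 / (16 * s\<^sup>2)) \<partial>\<Omega>) \<le> (\<integral>\<omega>. exp ((lin a \<omega>)\<^sup>2 / (4 * \<tau>\<^sup>2)) \<partial>\<Omega>)"
      using 1 le int by (intro integral_mono) (auto simp: has_bochner_integral_iff)
    also have "\<dots> = sqrt 2" using 1 by (simp add: has_bochner_integral_iff)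
    also have "\<dots> \<le> 2" using real_sqrt_le_mono[of 2 4] by simp
    finally show ?thesis using int by simp
  qed
  then show "integrable \<Omega> (\<lambda>\<omega>. exp ((lin a \<omega>)\<^sup>2 / (16 * s\<^sup>2)))"
    and "(\<integral>\<omega>. exp ((lin a \<omega>)\<^sup>2 / (16 * s\<^sup>2)) \<partial>\<Omega>) \<le> 2" by auto
qed

end

section \<open>The operator norm of the noise\<close>

lemma integrable_between_0:
  fixes f g :: "'a \<Rightarrow> real"
  assumes "integrable N g" "f \<in> borel_measurable N" "\<And>x. 0 \<le> f x" "\<And>x. f x \<le> g x"
  shows "integrable N f"
proof (rule Bochner_Integration.integrable_bound[OF assms(1,2)])
  have "norm (f x) \<le> norm (g x)" for x using assms(3,4)[of x] by simp
  then show "AE x in N. norm (f x) \<le> norm (g x)" by simp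
qed

text \<open>The \<open>M\<close>-th root of an exponential moment of size \<open>K ^ M\<close> is bounded: with \<open>t = y / M\<close> and
  \<open>r = exp t / K\<close>, the inequality \<open>r \<le> 1 + r ^ M\<close> replaces the concavity of the root. Hence a variable
  \<open>y\<close> whose exponential has mean of order \<open>K ^ M\<close> has second moment of order \<open>M\<^sup>2\<close>.\<close>

lemma square_le_exp_tempered:
  fixes y K :: real
  assumes "0 \<le> y" "0 < M" "1 \<le> K"
  shows "y\<^sup>2 \<le> 2 * (real M)\<^sup>2 * K * (1 + exp y / K ^ M)"
proof -
  define t where "t = y / real M"
  define r where "r = exp t / K"
  have t: "0 \<le> t" "y = real M * t" using assms by (auto simp: t_def)
  have r0: "0 \<le> r" using assms by (simp add: r_def)
  have rM: "r ^ M = exp y / K ^ M" by (simp add: r_def t power_divide exp_of_nat_mult)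
  have "r \<le> 1 + r ^ M"
  proof (cases "r \<le> 1")
    case True
    then show ?thesis using zero_le_power[OF r0, of M] by linarith
  next
    case False
    then show ?thesis using self_le_power[of r M] assms by simp
  qed
  then have "exp t \<le> K * (1 + exp y / K ^ M)"
    using assms unfolding rM by (simp add: r_def field_simps)
  moreover have "t\<^sup>2 / 2 \<le> exp t" using exp_lower_Taylor_quadratic[OF t(1)] t(1) by linarith
  ultimately have "t\<^sup>2 \<le> 2 * (K * (1 + exp y / K ^ M))" by linarith
  then have "(real M)\<^sup>2 * t\<^sup>2 \<le> (real M)\<^sup>2 * (2 * (K * (1 + exp y / K ^ M)))" by (rule mult_left_mono) simp
  moreover have "2 * (real M)\<^sup>2 * K * z = (real M)\<^sup>2 * (2 * (K * z))" for z by simp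
  ultimately show ?thesis by (simp only: t(2) power_mult_distrib)
qed

definition tensor :: "(nat \<Rightarrow> real) \<Rightarrow> (nat \<Rightarrow> real) \<Rightarrow> nat \<times> nat \<Rightarrow> real" where
  "tensor x y = (\<lambda>(i, j). x i * y j)"

definition unitv :: "nat \<Rightarrow> nat \<Rightarrow> real" where
  "unitv i k = (if k = i then 1 else 0)"

lemma dot_unitv: "i < M \<Longrightarrow> dot M (unitv i) x = x i" "i < M \<Longrightarrow> dot M x (unitv i) = x i"
  by (auto simp: dot_def unitv_def if_distrib[of "\<lambda>c. _ * c"] if_distrib[of "\<lambda>c. c * _"] sum.delta cong: if_cong)

text \<open>The factor \<open>144\<^sup>2\<close> undoes the scaling in \<open>exp_noise_norm_square_le\<close>, \<open>384\<^sup>2\<close> is the growth rate of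
  the number of pairs of grid vectors, and \<open>6 = 2 * (1 + 2)\<close> comes from \<open>square_le_exp_tempered\<close>, with
  the inner 2 from \<open>lin_exp_square\<close>.\<close>

definition noise_const :: real where "noise_const = 144\<^sup>2 * 6 * 384\<^sup>2"

lemma noise_const_ge1: "1 \<le> noise_const"
  by (simp add: noise_const_def)

locale gauss_matrix = gauss_family \<Omega> "{..<M} \<times> {..<M}" e s
  for \<Omega> :: "'w measure" and M :: nat and e :: "nat \<times> nat \<Rightarrow> 'w \<Rightarrow> real" and s :: real +
  assumes M_pos: "0 < M"
begin

definition noise :: "'w \<Rightarrow> nat \<Rightarrow> nat \<Rightarrow> real" where
  "noise \<omega> i j = e (i, j) \<omega>"

definition noise_norm :: "'w \<Rightarrow> real" where "noise_norm \<omega> = opn M (noise \<omega>)"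

lemma lin_tensor: "lin (tensor x y) \<omega> = dot M x (mv M (noise \<omega>) y)"
  unfolding lin_def tensor_def dot_def mv_def noise_def sum_distrib_left sum.cartesian_product
  by (intro sum.cong refl) (auto simp: mult_ac)

lemma ip_tensor: "ip (tensor x y) (tensor x' y') = dot M x x' * dot M y y'"
  unfolding ip_def tensor_def dot_def sum_product sum.cartesian_product
  by (intro sum.cong refl) (auto simp: mult_ac)

lemma noise_norm_nonneg: "0 \<le> noise_norm \<omega>"
  unfolding noise_norm_def by (rule opn_nonneg[OF M_pos])

lemma noise_norm_measurable [measurable]: "noise_norm \<in> borel_measurable \<Omega>"
  unfolding noise_norm_def noise_def by (rule opn_measurable[OF M_pos]) (intro X_measurable, auto)

lemma opn_add_noise_measurable [measurable]: "(\<lambda>\<omega>. opn M (\<lambda>i j. C i j + noise \<omega> i j)) \<in> borel_measurable \<Omega>"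
  unfolding noise_def
  by (rule opn_measurable[OF M_pos]) (intro borel_measurable_add borel_measurable_const X_measurable, auto)

text \<open>The maximum over the net is bounded by the sum over the net; \<open>144 = 3\<^sup>2 * 16\<close>, where the 3 is that of
  \<open>opn_le_grid\<close>.\<close>

lemma exp_noise_norm_square_le:
  "exp ((noise_norm \<omega>)\<^sup>2 / (144 * s\<^sup>2)) \<le> (\<Sum>(z, w)\<in>grid M \<times> grid M. exp ((lin (tensor (gridvec M z) (gridvec M w)) \<omega>)\<^sup>2 / (16 * s\<^sup>2)))"
    (is "_ \<le> (\<Sum>(z, w)\<in>_. ?f z w)")
proof -
  let ?G = "grid M \<times> grid M"
  let ?l = "\<lambda>p. \<bar>lin (tensor (gridvec M (fst p)) (gridvec M (snd p))) \<omega>\<bar>"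
  have fin: "finite ?G" by (simp add: finite_grid)
  obtain z0 where "z0 \<in> grid M"
    using opn_attained[OF M_pos] grid_approx[OF M_pos] by metis
  then have ne: "?l ` ?G \<noteq> {}" by blast
  define B where "B = Max (?l ` ?G)"
  have "B \<in> ?l ` ?G" unfolding B_def using fin ne by (intro Max_in) auto
  then obtain z w where zw: "z \<in> grid M" "w \<in> grid M" "B = ?l (z, w)" by auto
  have "noise_norm \<omega> \<le> 3 * B"
    unfolding noise_norm_def
  proof (rule opn_le_grid[OF M_pos])
    fix z w assume "z \<in> grid M" "w \<in> grid M"
    then have "?l (z, w) \<le> B" unfolding B_def using fin by (intro Max_ge imageI finite_imageI) auto
    then show "\<bar>dot M (gridvec M z) (mv M (noise \<omega>) (gridvec M w))\<bar> \<le> B" by (simp add: lin_tensor)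
  qed
  then have "(noise_norm \<omega>)\<^sup>2 \<le> (3 * B)\<^sup>2" using noise_norm_nonneg by (intro power_mono)
  then have "(noise_norm \<omega>)\<^sup>2 / (144 * s\<^sup>2) \<le> (3 * B)\<^sup>2 / (144 * s\<^sup>2)" by (intro divide_right_mono) auto
  also have "\<dots> = (lin (tensor (gridvec M z) (gridvec M w)) \<omega>)\<^sup>2 / (16 * s\<^sup>2)"
    using s_pos by (simp add: zw(3) power_mult_distrib field_simps)
  finally have "exp ((noise_norm \<omega>)\<^sup>2 / (144 * s\<^sup>2)) \<le> ?f z w" by simp
  also have "\<dots> = (\<lambda>(z, w). ?f z w) (z, w)" by simp
  also have "\<dots> \<le> (\<Sum>(z, w)\<in>?G. ?f z w)"
    using zw by (intro member_le_sum fin) auto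
  finally show ?thesis .
qed

lemma noise_norm_fourth:
  shows "integrable \<Omega> (\<lambda>\<omega>. noise_norm \<omega> ^ 4)"
    and "(\<integral>\<omega>. noise_norm \<omega> ^ 4 \<partial>\<Omega>) \<le> noise_const * s ^ 4 * (real M)\<^sup>2"
proof -
  let ?G = "grid M \<times> grid M"
  define K :: real where "K = 384\<^sup>2"
  define f where "f p \<omega> = exp ((lin (tensor (gridvec M (fst p)) (gridvec M (snd p))) \<omega>)\<^sup>2 / (16 * s\<^sup>2))" for p \<omega>
  define F where "F \<omega> = (\<Sum>p\<in>?G. f p \<omega>)" for \<omega>
  have ipG: "ip (tensor (gridvec M (fst p)) (gridvec M (snd p))) (tensor (gridvec M (fst p)) (gridvec M (snd p))) \<le> 4"
    if "p \<in> ?G" for p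
  proof -
    have "(vnorm M (gridvec M (fst p)))\<^sup>2 * (vnorm M (gridvec M (snd p)))\<^sup>2 \<le> 2 * 2"
      using that M_pos by (intro mult_mono vnorm_gridvec) auto
    then show ?thesis by (simp add: ip_tensor dot_self)
  qed
  have fI: "integrable \<Omega> (f p)" "(\<integral>\<omega>. f p \<omega> \<partial>\<Omega>) \<le> 2" if "p \<in> ?G" for p
    unfolding f_def using lin_exp_square[OF ipG[OF that]] by auto
  have FI: "integrable \<Omega> F" unfolding F_def using fI by (intro Bochner_Integration.integrable_sum) auto
  have "(\<integral>\<omega>. F \<omega> \<partial>\<Omega>) = (\<Sum>p\<in>?G. \<integral>\<omega>. f p \<omega> \<partial>\<Omega>)"
    unfolding F_def using fI by (intro Bochner_Integration.integral_sum) auto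
  also have "\<dots> \<le> (\<Sum>p\<in>?G. 2)" by (intro sum_mono fI)
  also have "\<dots> = 2 * (real (card (grid M)) * real (card (grid M)))" by (simp add: card_cartesian_product)
  also have "\<dots> \<le> 2 * (384 ^ M * 384 ^ M)" by (intro mult_left_mono mult_mono card_grid_le) auto
  also have "\<dots> = 2 * K ^ M" by (simp add: K_def power_mult_distrib[symmetric] power2_eq_square)
  finally have FE: "(\<integral>\<omega>. F \<omega> \<partial>\<Omega>) \<le> 2 * K ^ M" .
  have K: "1 \<le> K" "0 < K ^ M" by (auto simp: K_def)
  have le: "noise_norm \<omega> ^ 4 \<le> (144 * s\<^sup>2)\<^sup>2 * (2 * (real M)\<^sup>2 * K) * (1 + F \<omega> / K ^ M)" for \<omega>
  proof -
    let ?y = "(noise_norm \<omega>)\<^sup>2 / (144 * s\<^sup>2)"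
    have "?y\<^sup>2 \<le> 2 * (real M)\<^sup>2 * K * (1 + exp ?y / K ^ M)"
      by (intro square_le_exp_tempered M_pos K(1)) auto
    also have "\<dots> \<le> 2 * (real M)\<^sup>2 * K * (1 + F \<omega> / K ^ M)"
      using exp_noise_norm_square_le[of \<omega>] K
      by (intro mult_left_mono add_left_mono divide_right_mono) (auto simp: F_def f_def case_prod_beta)
    finally have "(144 * s\<^sup>2)\<^sup>2 * ?y\<^sup>2 \<le> (144 * s\<^sup>2)\<^sup>2 * (2 * (real M)\<^sup>2 * K * (1 + F \<omega> / K ^ M))"
      by (rule mult_left_mono) simp
    moreover have "(144 * s\<^sup>2)\<^sup>2 * ?y\<^sup>2 = noise_norm \<omega> ^ 4" using s_pos by (simp add: power_divide power_mult[symmetric])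
    ultimately show ?thesis by (simp only: mult.assoc)
  qed
  let ?R = "\<lambda>\<omega>. (144 * s\<^sup>2)\<^sup>2 * (2 * (real M)\<^sup>2 * K) * (1 + F \<omega> / K ^ M)"
  have RI: "integrable \<Omega> ?R" using FI by auto
  show int: "integrable \<Omega> (\<lambda>\<omega>. noise_norm \<omega> ^ 4)"
    by (rule integrable_between_0[OF RI _ _ le]) (auto simp: noise_norm_nonneg)
  have "(\<integral>\<omega>. noise_norm \<omega> ^ 4 \<partial>\<Omega>) \<le> (\<integral>\<omega>. ?R \<omega> \<partial>\<Omega>)" by (intro integral_mono int RI le)
  also have "\<dots> = (144 * s\<^sup>2)\<^sup>2 * (2 * (real M)\<^sup>2 * K) * (1 + (\<integral>\<omega>. F \<omega> \<partial>\<Omega>) / K ^ M)"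
    using FI by (simp add: prob_space)
  also have "\<dots> \<le> (144 * s\<^sup>2)\<^sup>2 * (2 * (real M)\<^sup>2 * K) * (1 + 2)"
    using FE K by (intro mult_left_mono add_left_mono) (auto simp: field_simps)
  also have "\<dots> = noise_const * s ^ 4 * (real M)\<^sup>2"
    by (simp add: noise_const_def K_def power_mult_distrib power_mult[symmetric])
  finally show "(\<integral>\<omega>. noise_norm \<omega> ^ 4 \<partial>\<Omega>) \<le> noise_const * s ^ 4 * (real M)\<^sup>2" .
qed

text \<open>A mean of squares of order \<open>a\<^sup>2\<close> forces a mean of order \<open>a\<close>. The arithmetic-geometric mean inequality
  \<open>f \<le> (a + f\<^sup>2 / a) / 2\<close> gives this together with integrability.\<close>

lemma moment_interpolation:
  fixes f :: "'w \<Rightarrow> real"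
  assumes f: "f \<in> borel_measurable \<Omega>" "\<And>\<omega>. 0 \<le> f \<omega>" and g: "integrable \<Omega> (\<lambda>\<omega>. (f \<omega>)\<^sup>2)"
    and le: "(\<integral>\<omega>. (f \<omega>)\<^sup>2 \<partial>\<Omega>) \<le> k * a\<^sup>2" and a: "0 < a" and k: "1 \<le> k"
  shows "integrable \<Omega> f" and "(\<integral>\<omega>. f \<omega> \<partial>\<Omega>) \<le> k * a"
proof -
  have pt: "f \<omega> \<le> (a + (f \<omega>)\<^sup>2 / a) / 2" for \<omega>
  proof -
    have "0 \<le> (f \<omega> - a)\<^sup>2 / a" using a by simp
    then show ?thesis using a by (simp add: power2_diff power2_eq_square field_simps)
  qed
  have RI: "integrable \<Omega> (\<lambda>\<omega>. (a + (f \<omega>)\<^sup>2 / a) / 2)" using g by auto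
  show int: "integrable \<Omega> f"
    by (rule integrable_between_0[OF RI f pt])
  have "(\<integral>\<omega>. f \<omega> \<partial>\<Omega>) \<le> (\<integral>\<omega>. (a + (f \<omega>)\<^sup>2 / a) / 2 \<partial>\<Omega>)" by (intro integral_mono int RI pt)
  also have "\<dots> = (a + (\<integral>\<omega>. (f \<omega>)\<^sup>2 \<partial>\<Omega>) / a) / 2" using g by (simp add: prob_space)
  also have "\<dots> \<le> (a + k * a\<^sup>2 / a) / 2" using le a by (intro divide_right_mono add_left_mono) auto
  also have "\<dots> \<le> k * a" using a k by (simp add: power2_eq_square field_simps)
  finally show "(\<integral>\<omega>. f \<omega> \<partial>\<Omega>) \<le> k * a" .
qed

lemma noise_norm_second:
  shows "integrable \<Omega> (\<lambda>\<omega>. (noise_norm \<omega>)\<^sup>2)" and "(\<integral>\<omega>. (noise_norm \<omega>)\<^sup>2 \<partial>\<Omega>) \<le> noise_const * (s\<^sup>2 * real M)"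
proof -
  have 4: "((noise_norm \<omega>)\<^sup>2)\<^sup>2 = noise_norm \<omega> ^ 4" for \<omega> by (simp add: power_mult[symmetric])
  show "integrable \<Omega> (\<lambda>\<omega>. (noise_norm \<omega>)\<^sup>2)" "(\<integral>\<omega>. (noise_norm \<omega>)\<^sup>2 \<partial>\<Omega>) \<le> noise_const * (s\<^sup>2 * real M)"
    using moment_interpolation[of "\<lambda>\<omega>. (noise_norm \<omega>)\<^sup>2" noise_const "s\<^sup>2 * real M"] noise_norm_fourth noise_const_ge1 s_pos M_pos
    by (auto simp: 4 power_mult_distrib power_mult[symmetric] mult.assoc)
qed

lemma noise_norm_first:
  shows "integrable \<Omega> noise_norm" and "(\<integral>\<omega>. noise_norm \<omega> \<partial>\<Omega>) \<le> noise_const * (s * sqrt (real M))"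
  using moment_interpolation[of noise_norm noise_const "s * sqrt (real M)"] noise_norm_second noise_const_ge1 s_pos M_pos noise_norm_nonneg
  by (auto simp: power_mult_distrib)

end

section \<open>Moments of the noisy matrix\<close>

context gauss_matrix
begin

definition obs :: "(nat \<Rightarrow> nat \<Rightarrow> real) \<Rightarrow> 'w \<Rightarrow> nat \<Rightarrow> nat \<Rightarrow> real" where
  "obs C \<omega> = (\<lambda>i j. C i j + noise \<omega> i j)"

lemma tmat_obs: "tmat (obs C \<omega>) = (\<lambda>i j. tmat C i j + tmat (noise \<omega>) i j)"
  by (simp add: obs_def tmat_def fun_eq_iff)

lemma noise_image: "i < M \<Longrightarrow> mv M (noise \<omega>) v i = lin (tensor (unitv i) v) \<omega>"
  by (simp add: lin_tensor dot_unitv)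

lemma noise_transp_image: "j < M \<Longrightarrow> mv M (tmat (noise \<omega>)) u j = lin (tensor u (unitv j)) \<omega>"
  by (simp add: lin_tensor dot_mv_tmat dot_unitv)

lemma noise_entry: "i < M \<Longrightarrow> j < M \<Longrightarrow> noise \<omega> i j = lin (tensor (unitv i) (unitv j)) \<omega>"
  by (simp add: noise_image[symmetric] mv_def unitv_def if_distrib[of "\<lambda>c. _ * c"] sum.delta cong: if_cong)

lemma dot_unitv_self: "i < M \<Longrightarrow> dot M (unitv i) (unitv i) = 1"
  by (simp add: dot_unitv unitv_def)

lemma vnorm_unitv [simp]: "i < M \<Longrightarrow> vnorm M (unitv i) = 1"
  using dot_unitv_self[of i] L2_set_nonneg[of "unitv i" "{..<M}"]
  by (simp add: dot_self power2_eq_1_iff)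

lemma affine_square: "has_bochner_integral \<Omega> (\<lambda>\<omega>. (c + lin a \<omega>)\<^sup>2) (c\<^sup>2 + s\<^sup>2 * ip a a)"
proof -
  have "has_bochner_integral \<Omega> (\<lambda>\<omega>. c\<^sup>2 + (2 * c) * lin a \<omega> + (lin a \<omega>)\<^sup>2) (c\<^sup>2 + (2 * c) * 0 + s\<^sup>2 * ip a a)"
    by (intro has_bochner_integral_add has_bochner_integral_mult_right lin_mean lin_square)
      (simp add: has_bochner_integral_iff prob_space)
  then show ?thesis by (simp add: power2_sum algebra_simps)
qed

lemma obs_image_second_moment:
  "has_bochner_integral \<Omega> (\<lambda>\<omega>. (vnorm M (mv M (obs C \<omega>) v))\<^sup>2)
     ((vnorm M (mv M C v))\<^sup>2 + s\<^sup>2 * real M * (vnorm M v)\<^sup>2)"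
proof -
  have "has_bochner_integral \<Omega> (\<lambda>\<omega>. \<Sum>i<M. (mv M C v i + lin (tensor (unitv i) v) \<omega>)\<^sup>2)
     (\<Sum>i<M. (mv M C v i)\<^sup>2 + s\<^sup>2 * ip (tensor (unitv i) v) (tensor (unitv i) v))"
    by (intro has_bochner_integral_sum affine_square)
  moreover have "(\<Sum>i<M. (mv M C v i + lin (tensor (unitv i) v) \<omega>)\<^sup>2) = (vnorm M (mv M (obs C \<omega>) v))\<^sup>2" for \<omega>
    unfolding vnorm_sq obs_def mv_add_mat by (intro sum.cong refl) (simp add: noise_image)
  moreover have "(\<Sum>i<M. (mv M C v i)\<^sup>2 + s\<^sup>2 * ip (tensor (unitv i) v) (tensor (unitv i) v))
      = (vnorm M (mv M C v))\<^sup>2 + s\<^sup>2 * real M * (vnorm M v)\<^sup>2"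
    by (simp add: ip_tensor dot_unitv_self dot_self vnorm_sq[of "mv M C v"] sum.distrib)
  ultimately show ?thesis by simp
qed

lemma obs_transp_image_second_moment:
  "has_bochner_integral \<Omega> (\<lambda>\<omega>. (vnorm M (mv M (tmat (obs C \<omega>)) u))\<^sup>2)
     ((vnorm M (mv M (tmat C) u))\<^sup>2 + s\<^sup>2 * real M * (vnorm M u)\<^sup>2)"
proof -
  have "has_bochner_integral \<Omega> (\<lambda>\<omega>. \<Sum>j<M. (mv M (tmat C) u j + lin (tensor u (unitv j)) \<omega>)\<^sup>2)
     (\<Sum>j<M. (mv M (tmat C) u j)\<^sup>2 + s\<^sup>2 * ip (tensor u (unitv j)) (tensor u (unitv j)))"
    by (intro has_bochner_integral_sum affine_square)
  moreover have "(\<Sum>j<M. (mv M (tmat C) u j + lin (tensor u (unitv j)) \<omega>)\<^sup>2) = (vnorm M (mv M (tmat (obs C \<omega>)) u))\<^sup>2" for \<omega>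
    unfolding vnorm_sq tmat_obs mv_add_mat by (intro sum.cong refl) (simp add: noise_transp_image)
  moreover have "(\<Sum>j<M. (mv M (tmat C) u j)\<^sup>2 + s\<^sup>2 * ip (tensor u (unitv j)) (tensor u (unitv j)))
      = (vnorm M (mv M (tmat C) u))\<^sup>2 + s\<^sup>2 * real M * (vnorm M u)\<^sup>2"
    by (simp add: ip_tensor dot_unitv_self dot_self vnorm_sq[of "mv M (tmat C) u"] sum.distrib)
  ultimately show ?thesis by simp
qed

definition chisq_dev :: "(nat \<Rightarrow> real) \<Rightarrow> 'w \<Rightarrow> real" where
  "chisq_dev v \<omega> = (vnorm M (mv M (noise \<omega>) v))\<^sup>2 - s\<^sup>2 * real M"

text \<open>The squared length of \<open>E v\<close> is \<open>s\<^sup>2\<close> times a chi-square variable with \<open>M\<close> degrees of freedom, whose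
  variance is \<open>2 M\<close>.\<close>

lemma chisq_dev_variance:
  assumes v: "vnorm M v = 1"
  shows "has_bochner_integral \<Omega> (\<lambda>\<omega>. (chisq_dev v \<omega>)\<^sup>2) (2 * s ^ 4 * real M)"
proof -
  let ?l = "\<lambda>i. lin (tensor (unitv i) v)" and ?m = "s\<^sup>2 * real M"
  let ?d = "\<lambda>i j. if i = j then 1 else 0 :: real"
  have ipl: "ip (tensor (unitv i) v) (tensor (unitv j) v) = ?d i j" if "i < M" "j < M" for i j
    using that by (simp add: ip_tensor dot_unitv dot_self v) (simp add: unitv_def)
  have 4: "has_bochner_integral \<Omega> (\<lambda>\<omega>. ?l i \<omega> * ?l i \<omega> * ?l j \<omega> * ?l j \<omega>) (s ^ 4 * (1 + 2 * ?d i j))" if "i < M" "j < M" for i j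
    using wick4[of "tensor (unitv i) v" "tensor (unitv i) v" "tensor (unitv j) v" "tensor (unitv j) v"] that
    by (simp add: ipl split: if_splits)
  have 2: "has_bochner_integral \<Omega> (\<lambda>\<omega>. ?l i \<omega> * ?l i \<omega>) (s\<^sup>2)" if "i < M" for i
    using wick2[of "tensor (unitv i) v" "tensor (unitv i) v"] that by (simp add: ipl)
  have "has_bochner_integral \<Omega> (\<lambda>\<omega>. (\<Sum>i<M. \<Sum>j<M. ?l i \<omega> * ?l i \<omega> * ?l j \<omega> * ?l j \<omega>)
       - (2 * ?m) * (\<Sum>i<M. ?l i \<omega> * ?l i \<omega>) + ?m\<^sup>2)
     ((\<Sum>i<M. \<Sum>j<M. s ^ 4 * (1 + 2 * ?d i j)) - (2 * ?m) * (\<Sum>i<M. s\<^sup>2) + ?m\<^sup>2)"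
    by (intro has_bochner_integral_add has_bochner_integral_diff has_bochner_integral_sum has_bochner_integral_mult_right 2 4)
      (auto simp: has_bochner_integral_iff prob_space)
  moreover have "(\<Sum>i<M. \<Sum>j<M. ?l i \<omega> * ?l i \<omega> * ?l j \<omega> * ?l j \<omega>)
       - (2 * ?m) * (\<Sum>i<M. ?l i \<omega> * ?l i \<omega>) + ?m\<^sup>2 = (chisq_dev v \<omega>)\<^sup>2" for \<omega>
  proof -
    have "(vnorm M (mv M (noise \<omega>) v))\<^sup>2 = (\<Sum>i<M. ?l i \<omega> * ?l i \<omega>)"
      unfolding vnorm_sq by (intro sum.cong refl) (simp add: noise_image power2_eq_square)
    moreover have "(\<Sum>i<M. \<Sum>j<M. ?l i \<omega> * ?l i \<omega> * ?l j \<omega> * ?l j \<omega>) = (\<Sum>i<M. ?l i \<omega> * ?l i \<omega>)\<^sup>2"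
      by (simp add: power2_eq_square sum_product mult.assoc)
    ultimately show ?thesis unfolding chisq_dev_def by (simp add: power2_diff)
  qed
  moreover have "(\<Sum>i<M. \<Sum>j<M. s ^ 4 * (1 + 2 * ?d i j)) - (2 * ?m) * (\<Sum>i<M. s\<^sup>2) + ?m\<^sup>2 = 2 * s ^ 4 * real M"
    by (simp add: sum_distrib_left[symmetric] sum.distrib sum.delta power2_eq_square power4_eq_xxxx algebra_simps)
  ultimately show ?thesis by simp
qed

lemma obs_image_deviation:
  "(vnorm M (mv M (obs C \<omega>) v))\<^sup>2 - ((vnorm M (mv M C v))\<^sup>2 + s\<^sup>2 * real M)
     = 2 * lin (tensor (mv M C v) v) \<omega> + chisq_dev v \<omega>"
proof -
  have "(vnorm M (mv M (obs C \<omega>) v))\<^sup>2 = (vnorm M (mv M C v))\<^sup>2 + 2 * dot M (mv M C v) (mv M (noise \<omega>) v)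
      + (vnorm M (mv M (noise \<omega>) v))\<^sup>2"
    unfolding obs_def mv_add_mat by (simp add: vnorm_sq dot_def power2_sum sum.distrib sum_distrib_left mult.assoc)
  then show ?thesis by (simp add: chisq_dev_def lin_tensor)
qed

text \<open>Sorting \<open>X\<^sup>T X v = C\<^sup>T C v + (E\<^sup>T C v + C\<^sup>T E v) + E\<^sup>T E v\<close> by degree in the noise.\<close>

lemma power_step_coordinate:
  assumes Cp: "\<And>i. i < M \<Longrightarrow> mv M (tmat C) (mv M C v) i = l2 * v i" and j: "j < M"
  shows "mv M (tmat (obs C \<omega>)) (mv M (obs C \<omega>) v) j
    = l2 * v j + lin (\<lambda>p. tensor (mv M C v) (unitv j) p + tensor (\<lambda>i. C i j) v p) \<omega>
      + (\<Sum>i<M. lin (tensor (unitv i) (unitv j)) \<omega> * lin (tensor (unitv i) v) \<omega>)"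
proof -
  let ?p = "mv M C v" and ?k = "mv M (noise \<omega>) v"
  have "mv M (tmat (obs C \<omega>)) (mv M (obs C \<omega>) v) j = (\<Sum>i<M. (C i j + noise \<omega> i j) * (?p i + ?k i))"
    unfolding obs_def mv_add_mat by (simp add: mv_def tmat_def)
  also have "\<dots> = (\<Sum>i<M. C i j * ?p i) + (\<Sum>i<M. noise \<omega> i j * ?p i) + (\<Sum>i<M. C i j * ?k i) + (\<Sum>i<M. noise \<omega> i j * ?k i)"
    unfolding distrib_left distrib_right sum.distrib by linarith
  also have "(\<Sum>i<M. C i j * ?p i) = l2 * v j" using Cp[OF j] by (simp add: mv_def tmat_def)
  also have "(\<Sum>i<M. noise \<omega> i j * ?p i) = lin (tensor ?p (unitv j)) \<omega>"
    unfolding noise_transp_image[OF j, symmetric] by (simp add: mv_def[of M "tmat (noise \<omega>)"] tmat_def)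
  also have "(\<Sum>i<M. C i j * ?k i) = lin (tensor (\<lambda>i. C i j) v) \<omega>"
    by (simp add: lin_tensor dot_def)
  also have "(\<Sum>i<M. noise \<omega> i j * ?k i) = (\<Sum>i<M. lin (tensor (unitv i) (unitv j)) \<omega> * lin (tensor (unitv i) v) \<omega>)"
    by (intro sum.cong refl) (simp add: noise_entry j noise_image)
  finally show ?thesis by (simp add: lin_add)
qed

text \<open>The terms of odd degree have mean zero. The constant interacts with the quadratic part through the
  mean of the latter.\<close>

lemma affine_quadratic_square:
  "has_bochner_integral \<Omega> (\<lambda>\<omega>. (c + lin a \<omega> + (\<Sum>i\<in>J. lin (f i) \<omega> * lin (g i) \<omega>))\<^sup>2)
    (c\<^sup>2 + s\<^sup>2 * ip a a + s ^ 4 * (\<Sum>i\<in>J. \<Sum>k\<in>J. ip (f i) (g i) * ip (f k) (g k)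
        + ip (f i) (f k) * ip (g i) (g k) + ip (f i) (g k) * ip (g i) (f k))
      + 2 * c * s\<^sup>2 * (\<Sum>i\<in>J. ip (f i) (g i)))"
proof -
  have "has_bochner_integral \<Omega> (\<lambda>\<omega>. (c + lin a \<omega>)\<^sup>2
      + (\<Sum>i\<in>J. \<Sum>k\<in>J. lin (f i) \<omega> * lin (g i) \<omega> * lin (f k) \<omega> * lin (g k) \<omega>)
      + (2 * c) * (\<Sum>i\<in>J. lin (f i) \<omega> * lin (g i) \<omega>) + 2 * (\<Sum>i\<in>J. lin a \<omega> * lin (f i) \<omega> * lin (g i) \<omega>))
    (c\<^sup>2 + s\<^sup>2 * ip a a + (\<Sum>i\<in>J. \<Sum>k\<in>J. s ^ 4 * (ip (f i) (g i) * ip (f k) (g k)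
        + ip (f i) (f k) * ip (g i) (g k) + ip (f i) (g k) * ip (g i) (f k)))
      + (2 * c) * (\<Sum>i\<in>J. s\<^sup>2 * ip (f i) (g i)) + 2 * (\<Sum>i\<in>J. 0))"
    by (intro has_bochner_integral_add has_bochner_integral_sum has_bochner_integral_mult_right
        affine_square wick2 wick3 wick4)
  moreover have "(c + lin a \<omega>)\<^sup>2
      + (\<Sum>i\<in>J. \<Sum>k\<in>J. lin (f i) \<omega> * lin (g i) \<omega> * lin (f k) \<omega> * lin (g k) \<omega>)
      + (2 * c) * (\<Sum>i\<in>J. lin (f i) \<omega> * lin (g i) \<omega>) + 2 * (\<Sum>i\<in>J. lin a \<omega> * lin (f i) \<omega> * lin (g i) \<omega>)
      = (c + lin a \<omega> + (\<Sum>i\<in>J. lin (f i) \<omega> * lin (g i) \<omega>))\<^sup>2" for \<omega>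
  proof -
    let ?Q = "\<Sum>i\<in>J. lin (f i) \<omega> * lin (g i) \<omega>"
    have 1: "(\<Sum>i\<in>J. \<Sum>k\<in>J. lin (f i) \<omega> * lin (g i) \<omega> * lin (f k) \<omega> * lin (g k) \<omega>) = ?Q\<^sup>2"
      by (simp add: power2_eq_square sum_product mult.assoc)
    have 2: "(\<Sum>i\<in>J. lin a \<omega> * lin (f i) \<omega> * lin (g i) \<omega>) = lin a \<omega> * ?Q"
      by (simp add: sum_distrib_left mult.assoc)
    show ?thesis unfolding 1 2 by (simp add: power2_eq_square distrib_left distrib_right)
  qed
  ultimately show ?thesis by (simp add: sum_distrib_left[symmetric] mult.assoc)
qed

text \<open>With \<open>|v| = 1\<close> and \<open>|C v| = l\<close>, the terms of \<open>|X\<^sup>T X v|\<^sup>2\<close> contribute in the mean: \<open>l\<^sup>4\<close> from the constant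
  part, \<open>2 l\<^sup>2 s\<^sup>2 M\<close> from its product with \<open>E\<^sup>T E v\<close>, at least \<open>l\<^sup>2 s\<^sup>2 M\<close> from the linear part, and
  \<open>s\<^sup>4 (2 M\<^sup>2 + M)\<close> from \<open>|E\<^sup>T E v|\<^sup>2\<close>. In the last one, \<open>M\<^sup>2\<close> is the squared length of the mean
  of \<open>E\<^sup>T E v\<close> and \<open>M\<^sup>2 + M\<close> the sum of the variances of its coordinates. The total exceeds the product
  \<open>(l\<^sup>2 + s\<^sup>2 M) (l\<^sup>2 + 2 s\<^sup>2 M)\<close>, whose second factor is what the mean of \<open>\<parallel>X\<parallel>\<^sup>2\<close> is compared with.\<close>

lemma power_step_second_moment:
  assumes v: "vnorm M v = 1" and p: "vnorm M (mv M C v) = l"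
    and Cp: "\<And>i. i < M \<Longrightarrow> mv M (tmat C) (mv M C v) i = l\<^sup>2 * v i"
  shows "integrable \<Omega> (\<lambda>\<omega>. (vnorm M (mv M (tmat (obs C \<omega>)) (mv M (obs C \<omega>) v)))\<^sup>2)"
    and "(l\<^sup>2 + s\<^sup>2 * real M) * (l\<^sup>2 + 2 * (s\<^sup>2 * real M))
      \<le> (\<integral>\<omega>. (vnorm M (mv M (tmat (obs C \<omega>)) (mv M (obs C \<omega>) v)))\<^sup>2 \<partial>\<Omega>)"
proof -
  let ?Y = "\<lambda>\<omega>. mv M (tmat (obs C \<omega>)) (mv M (obs C \<omega>) v)"
  let ?f = "\<lambda>j i. tensor (unitv i) (unitv j)" and ?g = "\<lambda>i. tensor (unitv i) v"
  define B where "B j = (\<lambda>q. tensor (mv M C v) (unitv j) q + tensor (\<lambda>i. C i j) v q)" for j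
  define E where "E j = (l\<^sup>2 * v j)\<^sup>2 + s\<^sup>2 * ip (B j) (B j)
      + s ^ 4 * ((real M)\<^sup>2 * (v j)\<^sup>2 + real M + real M * (v j)\<^sup>2) + 2 * (l\<^sup>2 * v j) * s\<^sup>2 * (real M * v j)" for j
  have hb: "has_bochner_integral \<Omega> (\<lambda>\<omega>. (?Y \<omega> j)\<^sup>2) (E j)" if j: "j < M" for j
  proof -
    have ipd: "ip (?f j i) (?g k) = (if i = k then v j else 0)" "ip (?g i) (?f j k) = (if i = k then v j else 0)"
      "ip (?f j i) (?f j k) = (if i = k then 1 else 0)" "ip (?g i) (?g k) = (if i = k then 1 else 0)"
      if "i < M" "k < M" for i k
      using that j by (auto simp: ip_tensor dot_unitv dot_self v) (auto simp: unitv_def)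
    have "(\<Sum>i<M. \<Sum>k<M. ip (?f j i) (?g i) * ip (?f j k) (?g k) + ip (?f j i) (?f j k) * ip (?g i) (?g k)
        + ip (?f j i) (?g k) * ip (?g i) (?f j k))
      = (\<Sum>i<M. \<Sum>k<M. (v j)\<^sup>2 + (if i = k then 1 + (v j)\<^sup>2 else 0))"
      by (intro sum.cong refl) (auto simp: ipd power2_eq_square)
    also have "\<dots> = (real M)\<^sup>2 * (v j)\<^sup>2 + real M + real M * (v j)\<^sup>2"
      by (simp add: sum.distrib sum.delta power2_eq_square algebra_simps)
    finally have 1: "(\<Sum>i<M. \<Sum>k<M. ip (?f j i) (?g i) * ip (?f j k) (?g k) + ip (?f j i) (?f j k) * ip (?g i) (?g k)
        + ip (?f j i) (?g k) * ip (?g i) (?f j k)) = (real M)\<^sup>2 * (v j)\<^sup>2 + real M + real M * (v j)\<^sup>2" .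
    have 2: "(\<Sum>i<M. ip (?f j i) (?g i)) = real M * v j" by (simp add: ipd)
    have "?Y \<omega> j = l\<^sup>2 * v j + lin (B j) \<omega> + (\<Sum>i<M. lin (?f j i) \<omega> * lin (?g i) \<omega>)" for \<omega>
      unfolding B_def by (rule power_step_coordinate[OF _ j]) (rule Cp)
    then show ?thesis
      using affine_quadratic_square[of "l\<^sup>2 * v j" "B j" "?f j" ?g "{..<M}"]
      unfolding E_def 1 2 by simp
  qed
  have ipB: "l\<^sup>2 \<le> ip (B j) (B j)" if j: "j < M" for j
  proof -
    have 1: "dot M (mv M C v) (\<lambda>i. C i j) = l\<^sup>2 * v j" "dot M (\<lambda>i. C i j) (mv M C v) = l\<^sup>2 * v j"
      using Cp[OF j] by (simp_all add: mv_def[of M "tmat C"] tmat_def dot_def mult.commute)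
    have "ip (B j) (B j) = l\<^sup>2 + 2 * (l\<^sup>2 * v j * v j) + dot M (\<lambda>i. C i j) (\<lambda>i. C i j)"
      unfolding B_def ip_add_left ip_add_right ip_tensor 1 dot_unitv_self[OF j] dot_unitv[OF j] dot_self p v by (simp add: j)
    then show ?thesis by (simp add: dot_self mult.assoc)
  qed
  have vv: "(\<Sum>j<M. (v j)\<^sup>2) = 1" using vnorm_sq[of v M] v by simp
  have tot: "has_bochner_integral \<Omega> (\<lambda>\<omega>. (vnorm M (?Y \<omega>))\<^sup>2) (\<Sum>j<M. E j)"
    unfolding vnorm_sq by (intro has_bochner_integral_sum hb) auto
  then show "integrable \<Omega> (\<lambda>\<omega>. (vnorm M (?Y \<omega>))\<^sup>2)" by (simp add: has_bochner_integral_iff)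
  let ?w = "l ^ 4 + s ^ 4 * ((real M)\<^sup>2 + real M) + 2 * l\<^sup>2 * s\<^sup>2 * real M"
  have "?w * 1 + real M * (s\<^sup>2 * l\<^sup>2 + s ^ 4 * real M)
      = (l\<^sup>2 + s\<^sup>2 * real M) * (l\<^sup>2 + 2 * (s\<^sup>2 * real M)) + s ^ 4 * real M"
    by (simp add: power2_eq_square power4_eq_xxxx algebra_simps)
  then have "(l\<^sup>2 + s\<^sup>2 * real M) * (l\<^sup>2 + 2 * (s\<^sup>2 * real M)) \<le> ?w * 1 + real M * (s\<^sup>2 * l\<^sup>2 + s ^ 4 * real M)"
    by simp
  also have "\<dots> = (\<Sum>j<M. ?w * (v j)\<^sup>2 + (s\<^sup>2 * l\<^sup>2 + s ^ 4 * real M))"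
    by (simp add: sum.distrib sum_distrib_left[symmetric] vv)
  also have "\<dots> \<le> (\<Sum>j<M. E j)"
  proof (intro sum_mono)
    fix j assume "j \<in> {..<M}"
    then have "s\<^sup>2 * l\<^sup>2 \<le> s\<^sup>2 * ip (B j) (B j)" using ipB by (intro mult_left_mono) auto
    then show "?w * (v j)\<^sup>2 + (s\<^sup>2 * l\<^sup>2 + s ^ 4 * real M) \<le> E j"
      unfolding E_def by (simp add: power2_eq_square power4_eq_xxxx algebra_simps)
  qed
  finally show "(l\<^sup>2 + s\<^sup>2 * real M) * (l\<^sup>2 + 2 * (s\<^sup>2 * real M)) \<le> (\<integral>\<omega>. (vnorm M (?Y \<omega>))\<^sup>2 \<partial>\<Omega>)"
    using tot by (simp add: has_bochner_integral_iff)
qed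

lemma opn_obs_le: "opn M (obs C \<omega>) \<le> opn M C + noise_norm \<omega>"
  unfolding obs_def noise_norm_def by (rule opn_add_le[OF M_pos])

lemma opn_le_obs: "opn M C \<le> opn M (obs C \<omega>) + noise_norm \<omega>"
proof (rule opn_leI[OF M_pos])
  fix x assume x: "vnorm M x = 1"
  have "mv M C x = (\<lambda>i. mv M (obs C \<omega>) x i + - 1 * mv M (noise \<omega>) x i)"
    unfolding obs_def mv_add_mat by simp
  then have "vnorm M (mv M C x) \<le> vnorm M (mv M (obs C \<omega>) x) + vnorm M (\<lambda>i. - 1 * mv M (noise \<omega>) x i)"
    using L2_set_triangle_ineq[of "mv M (obs C \<omega>) x" "\<lambda>i. - 1 * mv M (noise \<omega>) x i" "{..<M}"] by metis
  also have "\<dots> \<le> opn M (obs C \<omega>) + noise_norm \<omega>"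
    unfolding vnorm_scale noise_norm_def
    using vnorm_mv_le[OF M_pos, of "obs C \<omega>" x] vnorm_mv_le[OF M_pos, of "noise \<omega>" x] x by simp
  finally show "vnorm M (mv M C x) \<le> opn M (obs C \<omega>) + noise_norm \<omega>" .
qed

lemma opn_obs_square_le: "(opn M (obs C \<omega>))\<^sup>2 \<le> (opn M C)\<^sup>2 + (2 * opn M C * noise_norm \<omega> + (noise_norm \<omega>)\<^sup>2)"
proof -
  have "(opn M (obs C \<omega>))\<^sup>2 \<le> (opn M C + noise_norm \<omega>)\<^sup>2"
    using opn_obs_le opn_nonneg[OF M_pos] by (intro power_mono)
  then show ?thesis by (simp add: power2_sum)
qed

text \<open>Since \<open>\<parallel>X\<parallel>\<close> and \<open>\<parallel>C\<parallel>\<close> differ by at most \<open>\<parallel>E\<parallel>\<close>, their squares differ by at most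
  \<open>2 \<parallel>C\<parallel> \<parallel>E\<parallel> + \<parallel>E\<parallel>\<^sup>2\<close>.\<close>

lemma opn_obs_square_dev:
  "((opn M (obs C \<omega>))\<^sup>2 - (opn M C)\<^sup>2)\<^sup>2 \<le> 8 * (opn M C)\<^sup>2 * (noise_norm \<omega>)\<^sup>2 + 2 * noise_norm \<omega> ^ 4"
proof -
  let ?l = "opn M C" and ?n = "noise_norm \<omega>" and ?x = "opn M (obs C \<omega>)"
  have nn: "0 \<le> ?l" "0 \<le> ?n" "0 \<le> ?x" using opn_nonneg[OF M_pos] noise_norm_nonneg by auto
  have "?l\<^sup>2 - ?x\<^sup>2 \<le> 2 * ?l * ?n + ?n\<^sup>2"
  proof (cases "?n \<le> ?l")
    case True
    have "(?l - ?n)\<^sup>2 \<le> ?x\<^sup>2" using True opn_le_obs[of C \<omega>] by (intro power_mono) auto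
    moreover have "0 \<le> ?n\<^sup>2" by simp
    ultimately show ?thesis unfolding power2_diff by linarith
  next
    case False
    then have "?l * ?l \<le> ?l * ?n" using nn by (intro mult_left_mono) auto
    moreover have "0 \<le> ?l * ?n" using nn by simp
    moreover have "0 \<le> ?x\<^sup>2" "0 \<le> ?n\<^sup>2" by auto
    ultimately show ?thesis unfolding power2_eq_square[of ?l] by linarith
  qed
  then have "\<bar>?x\<^sup>2 - ?l\<^sup>2\<bar> \<le> 2 * ?l * ?n + ?n\<^sup>2" using opn_obs_square_le[of C \<omega>] by linarith
  then have "(?x\<^sup>2 - ?l\<^sup>2)\<^sup>2 \<le> (2 * ?l * ?n + ?n\<^sup>2)\<^sup>2"
    by (metis abs_ge_zero power2_abs power_mono)
  also have "\<dots> \<le> 2 * (2 * ?l * ?n)\<^sup>2 + 2 * (?n\<^sup>2)\<^sup>2"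
    using sum_squares_bound[of "2 * ?l * ?n" "?n\<^sup>2"] by (simp add: power2_sum)
  also have "\<dots> = 8 * ?l\<^sup>2 * ?n\<^sup>2 + 2 * ?n ^ 4" by (simp add: power_mult_distrib power_mult[symmetric])
  finally show ?thesis .
qed

lemma integrable_opn_obs_square: "integrable \<Omega> (\<lambda>\<omega>. (opn M (obs C \<omega>))\<^sup>2)"
proof (rule integrable_between_0[OF _ _ _ opn_obs_square_le])
  show "integrable \<Omega> (\<lambda>\<omega>. (opn M C)\<^sup>2 + (2 * opn M C * noise_norm \<omega> + (noise_norm \<omega>)\<^sup>2))"
    using noise_norm_first noise_norm_second by auto
  show "(\<lambda>\<omega>. (opn M (obs C \<omega>))\<^sup>2) \<in> borel_measurable \<Omega>" unfolding obs_def by measurable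
qed simp

lemma opn_obs_square_upper:
  "(\<integral>\<omega>. (opn M (obs C \<omega>))\<^sup>2 \<partial>\<Omega>) \<le> (opn M C)\<^sup>2 + noise_const * (2 * opn M C * (s * sqrt (real M)) + s\<^sup>2 * real M)"
proof -
  have "(\<integral>\<omega>. (opn M (obs C \<omega>))\<^sup>2 \<partial>\<Omega>) \<le> (\<integral>\<omega>. (opn M C)\<^sup>2 + (2 * opn M C * noise_norm \<omega> + (noise_norm \<omega>)\<^sup>2) \<partial>\<Omega>)"
    using noise_norm_first noise_norm_second by (intro integral_mono integrable_opn_obs_square opn_obs_square_le) auto
  also have "\<dots> = (opn M C)\<^sup>2 + (2 * opn M C * (\<integral>\<omega>. noise_norm \<omega> \<partial>\<Omega>) + (\<integral>\<omega>. (noise_norm \<omega>)\<^sup>2 \<partial>\<Omega>))"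
    using noise_norm_first noise_norm_second by (simp add: prob_space)
  also have "\<dots> \<le> (opn M C)\<^sup>2 + (2 * opn M C * (noise_const * (s * sqrt (real M))) + noise_const * (s\<^sup>2 * real M))"
    using noise_norm_first noise_norm_second opn_nonneg[OF M_pos, of C] by (intro add_left_mono add_mono mult_left_mono) auto
  finally show ?thesis by (simp add: algebra_simps)
qed

text \<open>With \<open>l = \<parallel>C\<parallel>\<close>, \<open>S = l\<^sup>2 + s\<^sup>2 M\<close>, \<open>a = \<parallel>X\<parallel>\<^sup>2 - l\<^sup>2\<close> and \<open>b = |X v|\<^sup>2 - S\<close>, the power step reads \<open>|X\<^sup>T X v|\<^sup>2 \<le> (l\<^sup>2 + a) (S + b)\<close>. The
  term \<open>S a\<close> is the wanted one and \<open>b\<close> has mean zero. The product \<open>a b\<close> is bounded by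
  \<open>(a\<^sup>2 / r + r b\<^sup>2) / 2\<close> with \<open>r = \<surd>M\<close>, the weight that balances the mean of \<open>a\<^sup>2\<close>, of order
  \<open>s\<^sup>2 M S\<close>, against that of \<open>b\<^sup>2\<close>, of order \<open>s\<^sup>2 S\<close>. Using the pointwise bounds \<open>A\<close> and \<open>B\<close> for \<open>a\<^sup>2\<close> and
  \<open>b\<^sup>2\<close>, all functions to be integrated have means that were computed or bounded before.\<close>

lemma opn_obs_square_lower:
  "(opn M C)\<^sup>2 + 2 * (s\<^sup>2 * real M) - 4 * (noise_const + 1) * s\<^sup>2 * sqrt (real M)
    \<le> (\<integral>\<omega>. (opn M (obs C \<omega>))\<^sup>2 \<partial>\<Omega>)"
proof -
  define l where "l = opn M C"
  obtain v where v: "vnorm M v = 1" and p: "vnorm M (mv M C v) = l"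
    and Cp: "\<And>i. i < M \<Longrightarrow> mv M (tmat C) (mv M C v) i = l\<^sup>2 * v i"
    using top_singular_vector[OF M_pos] unfolding l_def by metis
  define S where "S = l\<^sup>2 + s\<^sup>2 * real M"
  define r where "r = sqrt (real M)"
  have r: "r > 0" "r\<^sup>2 = real M" using M_pos by (auto simp: r_def)
  have S: "S > 0" using M_pos s_pos by (auto simp: S_def intro: add_nonneg_pos)
  let ?x = "\<lambda>\<omega>. (opn M (obs C \<omega>))\<^sup>2"
  let ?Y = "\<lambda>\<omega>. (vnorm M (mv M (tmat (obs C \<omega>)) (mv M (obs C \<omega>) v)))\<^sup>2"
  let ?L = "\<lambda>\<omega>. lin (tensor (mv M C v) v) \<omega>"
  let ?N = "\<lambda>\<omega>. (vnorm M (mv M (obs C \<omega>) v))\<^sup>2"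
  let ?A = "\<lambda>\<omega>. 8 * l\<^sup>2 * (noise_norm \<omega>)\<^sup>2 + 2 * noise_norm \<omega> ^ 4"
  let ?B = "\<lambda>\<omega>. 8 * (?L \<omega>)\<^sup>2 + 2 * (chisq_dev v \<omega>)\<^sup>2"
  have pt: "?Y \<omega> - l\<^sup>2 * ?N \<omega> - (?A \<omega> / r + r * ?B \<omega>) / 2 \<le> S * (?x \<omega> - l\<^sup>2)" for \<omega>
  proof -
    define a where "a = ?x \<omega> - l\<^sup>2"
    define b where "b = 2 * ?L \<omega> + chisq_dev v \<omega>"
    have N: "?N \<omega> = S + b" using obs_image_deviation[of C \<omega> v] by (simp add: S_def b_def p)
    have Y: "?Y \<omega> \<le> (l\<^sup>2 + a) * (S + b)"
      using power_step_le_opn[OF M_pos, of "obs C \<omega>" v] by (simp add: N[symmetric] a_def)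
    have A: "a\<^sup>2 \<le> ?A \<omega>" using opn_obs_square_dev[of C \<omega>] by (simp add: a_def l_def)
    have B: "b\<^sup>2 \<le> ?B \<omega>"
      using sum_squares_bound[of "2 * ?L \<omega>" "chisq_dev v \<omega>"] by (simp add: b_def power2_sum power_mult_distrib)
    have "0 \<le> (a - r * b)\<^sup>2 / r" using r by simp
    then have "a * b \<le> (a\<^sup>2 / r + r * b\<^sup>2) / 2"
      using r(1) by (simp add: power2_diff power2_eq_square field_simps)
    also have "\<dots> \<le> (?A \<omega> / r + r * ?B \<omega>) / 2"
      using A B r(1) by (intro divide_right_mono add_mono mult_left_mono) auto
    finally have ab: "a * b \<le> (?A \<omega> / r + r * ?B \<omega>) / 2" .
    have "(l\<^sup>2 + a) * (S + b) = l\<^sup>2 * (S + b) + S * a + a * b" by (simp add: algebra_simps)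
    then have "?Y \<omega> - l\<^sup>2 * (S + b) - (?A \<omega> / r + r * ?B \<omega>) / 2 \<le> S * a" using Y ab by linarith
    then show ?thesis by (simp add: N a_def)
  qed
  have YI: "integrable \<Omega> ?Y" and YE: "S * (l\<^sup>2 + 2 * (s\<^sup>2 * real M)) \<le> (\<integral>\<omega>. ?Y \<omega> \<partial>\<Omega>)"
    using power_step_second_moment[OF v p Cp] unfolding S_def by auto
  have NI: "integrable \<Omega> ?N" and NE: "(\<integral>\<omega>. ?N \<omega> \<partial>\<Omega>) = S"
    using obs_image_second_moment[of C v] by (auto simp: has_bochner_integral_iff v p S_def)
  have AI: "integrable \<Omega> ?A" using noise_norm_second noise_norm_fourth by auto
  have BI: "integrable \<Omega> ?B" and BE: "(\<integral>\<omega>. ?B \<omega> \<partial>\<Omega>) = 8 * (s\<^sup>2 * l\<^sup>2) + 2 * (2 * s ^ 4 * real M)"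
    using lin_square[of "tensor (mv M C v) v"] chisq_dev_variance[OF v]
    by (auto simp: has_bochner_integral_iff ip_tensor dot_self v p)
  have AE: "(\<integral>\<omega>. ?A \<omega> \<partial>\<Omega>) \<le> 8 * noise_const * s\<^sup>2 * r\<^sup>2 * S"
  proof -
    have "(\<integral>\<omega>. ?A \<omega> \<partial>\<Omega>) = 8 * l\<^sup>2 * (\<integral>\<omega>. (noise_norm \<omega>)\<^sup>2 \<partial>\<Omega>) + 2 * (\<integral>\<omega>. noise_norm \<omega> ^ 4 \<partial>\<Omega>)"
      using noise_norm_second noise_norm_fourth by simp
    also have "\<dots> \<le> 8 * l\<^sup>2 * (noise_const * (s\<^sup>2 * real M)) + 2 * (noise_const * s ^ 4 * (real M)\<^sup>2)"
      using noise_norm_second noise_norm_fourth by (intro add_mono mult_left_mono) auto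
    also have "\<dots> \<le> 8 * l\<^sup>2 * (noise_const * (s\<^sup>2 * real M)) + 8 * (noise_const * s ^ 4 * (real M)\<^sup>2)"
      using noise_const_ge1 by (intro add_left_mono mult_right_mono) auto
    also have "\<dots> = 8 * noise_const * s\<^sup>2 * r\<^sup>2 * S"
      unfolding r(2) S_def by (simp add: power2_eq_square power4_eq_xxxx algebra_simps)
    finally show ?thesis .
  qed
  have BE': "(\<integral>\<omega>. ?B \<omega> \<partial>\<Omega>) \<le> 8 * s\<^sup>2 * S"
  proof -
    have "8 * s\<^sup>2 * S = 8 * (s\<^sup>2 * l\<^sup>2) + 2 * (2 * s ^ 4 * real M) + 4 * (s ^ 4 * real M)"
      unfolding S_def by (simp add: power2_eq_square power4_eq_xxxx algebra_simps)
    then show ?thesis unfolding BE by simp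
  qed
  have "S * (l\<^sup>2 + 2 * (s\<^sup>2 * real M)) - l\<^sup>2 * S - (8 * noise_const * s\<^sup>2 * r\<^sup>2 * S / r + r * (8 * s\<^sup>2 * S)) / 2
      \<le> (\<integral>\<omega>. ?Y \<omega> \<partial>\<Omega>) - l\<^sup>2 * (\<integral>\<omega>. ?N \<omega> \<partial>\<Omega>) - ((\<integral>\<omega>. ?A \<omega> \<partial>\<Omega>) / r + r * (\<integral>\<omega>. ?B \<omega> \<partial>\<Omega>)) / 2"
    unfolding NE using YE AE BE' r(1)
    by (intro diff_mono divide_right_mono add_mono mult_left_mono order_refl) auto
  also have "\<dots> = (\<integral>\<omega>. ?Y \<omega> - l\<^sup>2 * ?N \<omega> - (?A \<omega> / r + r * ?B \<omega>) / 2 \<partial>\<Omega>)"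
    using YI NI AI BI by (simp only: Bochner_Integration.integral_diff Bochner_Integration.integral_add
      Bochner_Integration.integral_divide_zero Bochner_Integration.integral_mult_right_zero
      Bochner_Integration.integrable_diff Bochner_Integration.integrable_add
      Bochner_Integration.integrable_divide_zero Bochner_Integration.integrable_mult_right)
  also have "\<dots> \<le> (\<integral>\<omega>. S * (?x \<omega> - l\<^sup>2) \<partial>\<Omega>)"
  proof (rule integral_mono[OF _ _ pt])
    show "integrable \<Omega> (\<lambda>\<omega>. ?Y \<omega> - l\<^sup>2 * ?N \<omega> - (?A \<omega> / r + r * ?B \<omega>) / 2)"
      by (rule YI NI AI BI Bochner_Integration.integrable_diff Bochner_Integration.integrable_add
        Bochner_Integration.integrable_divide_zero Bochner_Integration.integrable_mult_right)+
    show "integrable \<Omega> (\<lambda>\<omega>. S * (?x \<omega> - l\<^sup>2))"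
      using integrable_opn_obs_square[of C] by auto
  qed
  also have "\<dots> = S * ((\<integral>\<omega>. ?x \<omega> \<partial>\<Omega>) - l\<^sup>2)"
    using integrable_opn_obs_square[of C] by (simp add: prob_space)
  also have "S * (l\<^sup>2 + 2 * (s\<^sup>2 * real M)) - l\<^sup>2 * S - (8 * noise_const * s\<^sup>2 * r\<^sup>2 * S / r + r * (8 * s\<^sup>2 * S)) / 2
      = S * (2 * (s\<^sup>2 * real M) - 4 * (noise_const + 1) * s\<^sup>2 * r)"
  proof -
    have "8 * noise_const * s\<^sup>2 * r\<^sup>2 * S / r = 8 * (noise_const * s\<^sup>2 * r * S)"
      using r(1) by (simp add: power2_eq_square[of r])
    then show ?thesis by (simp add: algebra_simps)
  qed
  finally have "S * (2 * (s\<^sup>2 * real M) - 4 * (noise_const + 1) * s\<^sup>2 * r) \<le> S * ((\<integral>\<omega>. ?x \<omega> \<partial>\<Omega>) - l\<^sup>2)" .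
  then show ?thesis using S by (simp add: l_def r_def)
qed

end

section \<open>Bounds for the excess of rank one\<close>

lemma gaussian_matrix_imp_gauss_matrix:
  assumes "gaussian_matrix \<Omega> M \<sigma> E" "0 < \<sigma>" "0 < M"
  shows "gauss_matrix \<Omega> M (\<lambda>ij \<omega>. E \<omega> $$ ij) \<sigma>"
proof -
  interpret prob_space \<Omega> using assms by (simp add: gaussian_matrix_def)
  show ?thesis
    by unfold_locales (use assms in \<open>auto simp: gaussian_matrix_def\<close>)
qed

text \<open>Both maximizers are evaluated at a unit vector where the maximum is attained. The mean that defines
  the second one is \<open>|C\<^sup>T u|\<^sup>2 + \<sigma>\<^sup>2 M\<close>, so it is maximal where \<open>|C\<^sup>T u|\<close> is.\<close>

lemma excess_rank_1_bounds:
  assumes E: "gaussian_matrix \<Omega> M \<sigma> E" and \<sigma>: "0 < \<sigma>" and M: "0 < M" and C: "C \<in> carrier_mat M M"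
  shows "excess \<Omega> E M 1 C \<le> noise_const * (2 * spectral_norm C * (\<sigma> * sqrt (real M)) + \<sigma>\<^sup>2 * real M) - \<sigma>\<^sup>2 * real M"
    and "\<sigma>\<^sup>2 * real M - 4 * (noise_const + 1) * \<sigma>\<^sup>2 * sqrt (real M) \<le> excess \<Omega> E M 1 C"
proof -
  interpret gauss_matrix \<Omega> M "\<lambda>ij \<omega>. E \<omega> $$ ij" \<sigma>
    by (rule gaussian_matrix_imp_gauss_matrix[OF E \<sigma> M])
  let ?X = "\<lambda>\<omega>. C + E \<omega>" and ?D = "entries C"
  let ?F = "\<lambda>P. \<integral>\<omega>. (hs_norm (P * ?X \<omega>))\<^sup>2 \<partial>\<Omega>"
  have EM: "E \<omega> \<in> carrier_mat M M" if "\<omega> \<in> space \<Omega>" for \<omega>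
    using E that by (simp add: gaussian_matrix_def)
  have XM: "?X \<omega> \<in> carrier_mat M M" if "\<omega> \<in> space \<Omega>" for \<omega>
    using EM[OF that] C by auto
  have ent: "entries (?X \<omega>) i j = obs ?D \<omega> i j" if "\<omega> \<in> space \<Omega>" "i < M" "j < M" for \<omega> i j
    using EM[OF that(1)] C that by (auto simp: entries_def obs_def noise_def)
  have hat: "(\<integral>\<omega>. (hs_norm (pi_hat M 1 (?X \<omega>) * ?X \<omega>))\<^sup>2 \<partial>\<Omega>) = (\<integral>\<omega>. (opn M (obs ?D \<omega>))\<^sup>2 \<partial>\<Omega>)"
    by (intro Bochner_Integration.integral_cong refl)
      (simp only: hs_norm_pi_hat[OF M XM] opn_cong[OF ent])
  have F: "?F (rank1 M u) = (vnorm M (mv M (tmat ?D) u))\<^sup>2 + \<sigma>\<^sup>2 * real M" if u: "vnorm M u = 1" for u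
  proof -
    have "?F (rank1 M u) = (\<integral>\<omega>. (vnorm M (mv M (tmat (obs ?D \<omega>)) u))\<^sup>2 \<partial>\<Omega>)"
    proof (intro Bochner_Integration.integral_cong refl)
      fix \<omega> assume w: "\<omega> \<in> space \<Omega>"
      have "vnorm M (mv M (tmat (entries (?X \<omega>))) u) = vnorm M (mv M (tmat (obs ?D \<omega>)) u)"
        by (rule vnorm_mv_cong) (simp add: tmat_def ent[OF w])
      then show "(hs_norm (rank1 M u * ?X \<omega>))\<^sup>2 = (vnorm M (mv M (tmat (obs ?D \<omega>)) u))\<^sup>2"
        by (simp add: hs_norm_rank1_mult[OF XM[OF w] u])
    qed
    then show ?thesis
      using obs_transp_image_second_moment[of ?D u] u by (simp add: has_bochner_integral_iff)
  qed
  obtain u where u: "vnorm M u = 1" "vnorm M (mv M (tmat ?D) u) = opn M (tmat ?D)"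
    using opn_attained[OF M] by blast
  have "?F (pi_opt \<Omega> M 1 ?X) = ?F (rank1 M u)"
    unfolding pi_opt_def
  proof (rule arg_max_on_value)
    show "rank1 M u \<in> orth_projs M 1" using u unfolding orth_projs_1 by auto
    fix P assume "P \<in> orth_projs M 1"
    then obtain w where w: "vnorm M w = 1" "P = rank1 M w" unfolding orth_projs_1 by auto
    have "vnorm M (mv M (tmat ?D) w) \<le> opn M (tmat ?D)"
      using vnorm_mv_le[OF M, of "tmat ?D" w] w(1) by simp
    then show "?F P \<le> ?F (rank1 M u)"
      unfolding w(2) F[OF w(1)] F[OF u(1)] u(2) by (intro add_right_mono power_mono) auto
  qed
  also have "\<dots> = (opn M ?D)\<^sup>2 + \<sigma>\<^sup>2 * real M"
    unfolding F[OF u(1)] u(2) by (simp add: opn_tmat[OF M])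
  finally have eq: "excess \<Omega> E M 1 C = (\<integral>\<omega>. (opn M (obs ?D \<omega>))\<^sup>2 \<partial>\<Omega>) - ((opn M ?D)\<^sup>2 + \<sigma>\<^sup>2 * real M)"
    unfolding excess_def Let_def hat by simp
  show "excess \<Omega> E M 1 C \<le> noise_const * (2 * spectral_norm C * (\<sigma> * sqrt (real M)) + \<sigma>\<^sup>2 * real M) - \<sigma>\<^sup>2 * real M"
    using opn_obs_square_upper[of ?D] unfolding eq spectral_norm_eq_opn[OF C] by linarith
  show "\<sigma>\<^sup>2 * real M - 4 * (noise_const + 1) * \<sigma>\<^sup>2 * sqrt (real M) \<le> excess \<Omega> E M 1 C"
    using opn_obs_square_lower[of ?D] unfolding eq by linarith
qed

theorem theorem1p2:
  shows "(\<exists>c\<^sub>2>0. \<forall>M\<ge>2. \<forall>\<sigma>>0. \<forall>(\<Omega> :: 'w measure) E. gaussian_matrix \<Omega> M \<sigma> E \<longrightarrow>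
            (\<forall>C \<in> carrier_mat M M.
               excess \<Omega> E M 1 C \<le> c\<^sub>2 * (\<sigma>\<^sup>2 * real M + \<sigma> * sqrt (real M) * spectral_norm C)))
       \<and> (\<exists>c\<^sub>3>0. \<exists>M\<^sub>0. \<forall>\<sigma>>0. \<forall>M\<ge>M\<^sub>0. \<forall>(\<Omega> :: 'w measure) E. gaussian_matrix \<Omega> M \<sigma> E \<longrightarrow>
            (INF C \<in> carrier_mat M M. ereal (excess \<Omega> E M 1 C))
              \<ge> ereal (c\<^sub>3 * \<sigma>\<^sup>2 * (real M - 1)))"
proof (rule conjI)
  show "\<exists>c\<^sub>2>0. \<forall>M\<ge>2. \<forall>\<sigma>>0. \<forall>(\<Omega> :: 'w measure) E. gaussian_matrix \<Omega> M \<sigma> E \<longrightarrow>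
            (\<forall>C \<in> carrier_mat M M.
               excess \<Omega> E M 1 C \<le> c\<^sub>2 * (\<sigma>\<^sup>2 * real M + \<sigma> * sqrt (real M) * spectral_norm C))"
  proof (intro exI[of _ "2 * noise_const"] conjI allI impI ballI)
    show "0 < 2 * noise_const" using noise_const_ge1 by simp
    fix M :: nat and \<sigma> :: real and \<Omega> :: "'w measure" and E :: "'w \<Rightarrow> real mat" and C :: "real mat"
    assume M: "2 \<le> M" and \<sigma>: "0 < \<sigma>" and E: "gaussian_matrix \<Omega> M \<sigma> E" and C: "C \<in> carrier_mat M M"
    have "0 \<le> noise_const * (\<sigma>\<^sup>2 * real M)" "0 \<le> \<sigma>\<^sup>2 * real M"
      using noise_const_ge1 by auto
    moreover have "2 * noise_const * (\<sigma>\<^sup>2 * real M + \<sigma> * sqrt (real M) * spectral_norm C)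
        = noise_const * (2 * spectral_norm C * (\<sigma> * sqrt (real M)) + \<sigma>\<^sup>2 * real M) + noise_const * (\<sigma>\<^sup>2 * real M)"
      by (simp add: algebra_simps)
    moreover have "0 < M" using M by simp
    ultimately show "excess \<Omega> E M 1 C \<le> 2 * noise_const * (\<sigma>\<^sup>2 * real M + \<sigma> * sqrt (real M) * spectral_norm C)"
      using excess_rank_1_bounds(1)[OF E \<sigma> _ C] by linarith
  qed
  \<comment> \<open>twice the constant of the lower bound, so that its error is at most \<open>\<sigma>\<^sup>2 M / 2\<close> once \<open>k \<le> \<surd>M\<close>\<close>
  define k where "k = 8 * (noise_const + 1)"
  have k: "0 < k" using noise_const_ge1 by (simp add: k_def)
  show "\<exists>c\<^sub>3>0. \<exists>M\<^sub>0. \<forall>\<sigma>>0. \<forall>M\<ge>M\<^sub>0. \<forall>(\<Omega> :: 'w measure) E. gaussian_matrix \<Omega> M \<sigma> E \<longrightarrow>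
            (INF C \<in> carrier_mat M M. ereal (excess \<Omega> E M 1 C)) \<ge> ereal (c\<^sub>3 * \<sigma>\<^sup>2 * (real M - 1))"
  proof (intro exI[of _ "1/2"] exI[of _ "nat \<lceil>k\<^sup>2\<rceil>"] conjI allI impI)
    fix M :: nat and \<sigma> :: real and \<Omega> :: "'w measure" and E :: "'w \<Rightarrow> real mat"
    assume \<sigma>: "0 < \<sigma>" and M0: "nat \<lceil>k\<^sup>2\<rceil> \<le> M" and E: "gaussian_matrix \<Omega> M \<sigma> E"
    have k2: "k\<^sup>2 \<le> real M" using M0 by linarith
    then have "0 < real M" using k by (meson less_le_trans zero_less_power)
    then have M: "0 < M" by simp
    have "k * sqrt (real M) \<le> sqrt (real M) * sqrt (real M)"
      using k2 k by (intro mult_right_mono real_le_rsqrt) auto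
    then have "\<sigma>\<^sup>2 * (k * sqrt (real M)) \<le> \<sigma>\<^sup>2 * real M" by (intro mult_left_mono) auto
    moreover have "4 * (noise_const + 1) * \<sigma>\<^sup>2 * sqrt (real M) = \<sigma>\<^sup>2 * (k * sqrt (real M)) / 2"
      by (simp add: k_def)
    moreover have "1/2 * \<sigma>\<^sup>2 * (real M - 1) = \<sigma>\<^sup>2 * real M / 2 - \<sigma>\<^sup>2 / 2"
      by (simp add: field_simps)
    ultimately have *: "1/2 * \<sigma>\<^sup>2 * (real M - 1) \<le> \<sigma>\<^sup>2 * real M - 4 * (noise_const + 1) * \<sigma>\<^sup>2 * sqrt (real M)"
      using zero_le_power2[of \<sigma>] by linarith
    show "(INF C \<in> carrier_mat M M. ereal (excess \<Omega> E M 1 C)) \<ge> ereal (1/2 * \<sigma>\<^sup>2 * (real M - 1))"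
    proof (rule INF_greatest)
      fix C :: "real mat" assume C: "C \<in> carrier_mat M M"
      show "ereal (1/2 * \<sigma>\<^sup>2 * (real M - 1)) \<le> ereal (excess \<Omega> E M 1 C)"
        using * excess_rank_1_bounds(2)[OF E \<sigma> M C] by simp
    qed
  qed simp
qed

end
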